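(* Let $n \ge 1$ be an integer and let $f$ be a real $1$-periodic function which is expandable as a Fourier series. Then $f$ is a solution of the functional equations $(E_{n,a})$, $$f(a x) = a^{n-1} \sum_{k=0}^{a-1} f\left(x + \frac{k}{a}\right),$$ for all integers $a \geq 2$ if and only if it has the form $$f(x) = \alpha \sum_{k=1}^{+\infty} \frac{\cos(2\pi k x)}{k^n} + \beta \sum_{k=1}^{+\infty} \frac{\sin(2\pi k x)}{k^n}$$ where $\alpha, \beta \in \mathbb{R}$, or equivalently the form $$f(x) = \lambda B_n(x) + \mu \overline{B}_n(x) \qquad (\text{valid for all } x \in [0,1) \text{ if } n \geq 2 \text{ and all } x \in (0,1) \text{ if } n = 1)$$ where $\lambda, \mu \in \mathbb{R}$.
   Context: $B_n(X)$ denotes the $n$-th Bernoulli polynomial, defined by the exponential generating function $\frac{t e^{Xt}}{e^t-1} = \sum_{n=0}^{+\infty} B_n(X)\frac{t^n}{n!}$. For all integers $n\ge 1$ and $x\in[0,1)$ with $(n,x)\neq(1,0)$, define $$\overline{B}_n(x) = \frac{-2\cdot n!}{(2\pi)^n} \sum_{k=1}^{+\infty} \frac{\sin\left(2\pi k x - \frac{n\pi}{2}\right)}{k^n}.$$ "$f$ is expandable as a Fourier series" means that there are complex numbers $(\alpha_k)_{k\in\mathbb{Z}}$ such that $f(x) = \sum_{k \in \mathbb{Z}} \alpha_k e^{2\pi i k x}$ at every point $x$ of the domain of $f$, the series being convergent in the sense of symmetric partial sums $\sum_{|k|\le N}$, $N\to\infty$. The domain of $f$ is $\mathbb{R}$;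 when $n=1$ the domain is also allowed to be $\mathbb{R}\setminus\mathbb{Z}$ (e.g. $f(x)=\log(2|\sin(\pi x)|)$). The first form of $f$ and $(E_{n,a})$ are understood for all real $x$ when the domain is $\mathbb{R}$; when the domain is $\mathbb{R}\setminus\mathbb{Z}$, the expansion and first form of $f$ are understood for all $x\in\mathbb{R}\setminus\mathbb{Z}$ and $(E_{n,a})$ for all real $x$ with $ax\notin\mathbb{Z}$. *)

theory Defs
  imports "HOL-Analysis.Analysis" "HOL-Computational_Algebra.Formal_Power_Series"
begin

text \<open>
  A function with domain \<open>D\<close> is a total function of type \<open>real \<Rightarrow> real\<close> whose values outside \<open>D\<close>
  are never used.  Below, \<open>D\<close> is \<open>UNIV\<close> or \<open>- \<int>\<close>.
\<close>

definition periodic1_on :: "real set \<Rightarrow> (real \<Rightarrow> real) \<Rightarrow> bool" where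
  "periodic1_on D f \<longleftrightarrow> (\<forall>x\<in>D. f (x + 1) = f x)"

definition fourier_expandable_on :: "real set \<Rightarrow> (real \<Rightarrow> real) \<Rightarrow> bool" where
  "fourier_expandable_on D f \<longleftrightarrow>
     (\<exists>\<alpha> :: int \<Rightarrow> complex. \<forall>x\<in>D.
        (\<lambda>N. \<Sum>k\<in>{- int N..int N}. \<alpha> k * exp (2 * of_real pi * \<i> * of_int k * of_real x))
          \<longlonglongrightarrow> complex_of_real (f x))"

text \<open>
  The equation is required wherever its left-hand side is defined.  For \<open>D = - \<int>\<close>,
  \<open>a * x \<notin> \<int>\<close> already implies \<open>x + k / a \<notin> \<int>\<close>, so the right-hand side is defined too.
\<close>

definition functional_eq_on :: "real set \<Rightarrow> nat \<Rightarrow> nat \<Rightarrow> (real \<Rightarrow> real) \<Rightarrow> bool" where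
  "functional_eq_on D n a f \<longleftrightarrow>
     (\<forall>x. real a * x \<in> D \<longrightarrow>
        f (real a * x) = real a ^ (n - 1) * (\<Sum>k<a. f (x + real k / real a)))"

text \<open>The coefficient of \<open>t ^ n / n!\<close> in \<open>t * exp (x * t) / (exp t - 1)\<close>.\<close>

definition bernoulli_poly :: "nat \<Rightarrow> real \<Rightarrow> real" where
  "bernoulli_poly n x = fact n * fps_nth (fps_X * fps_exp x / (fps_exp 1 - 1)) n"

lemma bernoulli_poly_generating_function:
  "Abs_fps (\<lambda>n. bernoulli_poly n x / fact n) * (fps_exp 1 - 1) = fps_X * fps_exp x"
proof -
  have nz: "fps_exp (1::real) - 1 \<noteq> 0"
    by (auto simp: fps_eq_iff intro!: exI[of _ 1])
  have "subdegree (fps_exp (1::real) - 1) = 1"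
    by (rule subdegreeI) auto
  moreover have "subdegree (fps_X * fps_exp x) = 1"
    by (rule subdegreeI) auto
  ultimately have "(fps_exp 1 - 1) dvd fps_X * fps_exp x"
    using nz by (subst fps_dvd_iff) (auto simp: fps_eq_iff)
  moreover have "Abs_fps (\<lambda>n. bernoulli_poly n x / fact n) = fps_X * fps_exp x / (fps_exp 1 - 1)"
    by (simp add: fps_eq_iff bernoulli_poly_def)
  ultimately show ?thesis by simp
qed

text \<open>
  For \<open>n \<ge> 1\<close> the series converges unless \<open>n = 1\<close> and \<open>x \<in> \<int>\<close>; the value there is never used.
\<close>

definition bernoulli_conj :: "nat \<Rightarrow> real \<Rightarrow> real" where
  "bernoulli_conj n x =
     - 2 * fact n / (2 * pi) ^ n *
       (\<Sum>k. sin (2 * pi * real (Suc k) * x - real n * pi / 2) / real (Suc k) ^ n)"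

text \<open>
  Since \<open>suminf\<close> of a divergent series is an unspecified number, convergence of every series that
  occurs with a nonzero coefficient is part of the definition.  This matters only for \<open>n = 1\<close> at
  integer points of the domain, where the cosine series is the harmonic series: there the
  representation is possible with \<open>\<alpha> = 0\<close> only.
\<close>

definition trig_form_on :: "real set \<Rightarrow> nat \<Rightarrow> (real \<Rightarrow> real) \<Rightarrow> bool" where
  "trig_form_on D n f \<longleftrightarrow>
     (\<exists>\<alpha> \<beta> :: real. \<forall>x\<in>D.
        (\<alpha> \<noteq> 0 \<longrightarrow> summable (\<lambda>k. cos (2 * pi * real (Suc k) * x) / real (Suc k) ^ n)) \<and>
        (\<beta> \<noteq> 0 \<longrightarrow> summable (\<lambda>k. sin (2 * pi * real (Suc k) * x) / real (Suc k) ^ n)) \<and>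
        f x = \<alpha> * (\<Sum>k. cos (2 * pi * real (Suc k) * x) / real (Suc k) ^ n)
            + \<beta> * (\<Sum>k. sin (2 * pi * real (Suc k) * x) / real (Suc k) ^ n))"

definition bernoulli_form :: "nat \<Rightarrow> (real \<Rightarrow> real) \<Rightarrow> bool" where
  "bernoulli_form n f \<longleftrightarrow>
     (\<exists>l m :: real. \<forall>x\<in>(if n = 1 then {0<..<1} else {0..<1}).
        f x = l * bernoulli_poly n x + m * bernoulli_conj n x)"

end

theory Submission
  imports Defs "HOL-Probability.Characteristic_Functions" "HOL-Real_Asymp.Real_Asymp"
begin

text \<open>
  Write \<open>f x = (\<Sum>k. c k * e k x)\<close> with \<open>e k x = exp (2 * pi * \<i> * k * x)\<close>. Averaging over the translates
  by \<open>j / a\<close> keeps exactly the frequencies divisible by \<open>a\<close>, so the functional equation for \<open>a\<close> says that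
  \<open>(\<Sum>k. (a ^ n * c (a * k) - c k) * e k y)\<close> sums to \<open>0\<close> at \<open>y = a * x\<close>. If a trigonometric series that sums to
  \<open>0\<close> has only zero coefficients, then the functional equations for all \<open>a \<ge> 2\<close> are equivalent to
  \<open>c (a * k) = c k / a ^ n\<close>, that is, to \<open>c 0 = 0\<close>, \<open>c k = c 1 / k ^ n\<close> and \<open>c (- k) = c (- 1) / k ^ n\<close> for
  \<open>k \<ge> 1\<close>. For real \<open>f\<close> this is the trigonometric form, which is written as
  \<open>Re (w * periodic_zeta n x)\<close> with one complex parameter \<open>w\<close>.

  The expansion of \<open>f\<close> is merely pointwise convergent, so the coefficients are not given by
  integrals, and the uniqueness statement is Cantor's theorem with the integers as possible
  exceptional set (\<open>trig_series_uniqueness\<close>). Its proof has four ingredients: coefficients of a series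
  that converges off the integers tend to \<open>0\<close> (\<open>coeffs_vanish_of_convergence\<close>); multiplication by
  \<open>e (- 1) - 1\<close> removes the exceptional points; shifting the coefficients reduces everything to the
  zeroth coefficient; and this one vanishes by a maximum principle (\<open>constant_trig_series_nonneg\<close>):
  at a maximum of the twice integrated series, Gaussian averages do not exceed the value, which
  bounds the sum of the original series from one side.

  For the second equivalence, the Bernoulli polynomial and its conjugate function are, up to a common
  real factor, the real and the imaginary part of the rotated periodic zeta function
  (\<open>bernoulli_poly_eq_periodic_zeta\<close>, \<open>bernoulli_conj_eq_periodic_zeta\<close>). This is proved by induction on
  \<open>n\<close> from the sawtooth wave; the constant of integration is determined by the functional equation for
  \<open>a = 2\<close>. As the Bernoulli form speaks about the unit interval only, uniqueness is used once more
  to extend the resulting representation to the integers when these belong to the domain.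
\<close>

section \<open>Series with monotone weights\<close>

text \<open>
  Summation by parts. The sums of the weight differences telescope, so the only
  information needed about the terms is a bound for their block sums; both the conditional
  convergence of the periodic zeta function and the limit theorem below rest on this estimate.
\<close>

lemma norm_weighted_sum_le:
  fixes a :: "nat \<Rightarrow> 'a::real_normed_vector" and w :: "nat \<Rightarrow> real"
  assumes dec: "\<And>k. w (Suc k) \<le> w k" and nonneg: "\<And>k. 0 \<le> w k"
    and bound: "\<And>k. m \<le> k \<Longrightarrow> norm (\<Sum>i\<in>{m..<k}. a i) \<le> B" and "m \<le> n"
  shows "norm (\<Sum>i\<in>{m..<n}. w i *\<^sub>R a i) \<le> B * w m"
proof -
  define A where "A k = (\<Sum>i\<in>{m..<k}. a i)" for k
  have parts: "(\<Sum>i\<in>{m..<n}. w i *\<^sub>R a i)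
      = w n *\<^sub>R A n + (\<Sum>i\<in>{m..<n}. (w i - w (Suc i)) *\<^sub>R A (Suc i))"
    using \<open>m \<le> n\<close>
    by (induction n rule: dec_induct) (simp_all add: A_def algebra_simps)
  have "norm (\<Sum>i\<in>{m..<n}. (w i - w (Suc i)) *\<^sub>R A (Suc i)) \<le> (\<Sum>i\<in>{m..<n}. (w i - w (Suc i)) * B)"
    using dec bound by (intro sum_norm_le) (auto simp: A_def simp del: sum.op_ivl_Suc intro!: mult_left_mono)
  also have "\<dots> = (w m - w n) * B"
    using \<open>m \<le> n\<close> by (simp add: sum_distrib_right [symmetric] sum_Suc_diff' [of m n "\<lambda>i. - w i", simplified])
  finally have "norm (\<Sum>i\<in>{m..<n}. (w i - w (Suc i)) *\<^sub>R A (Suc i)) \<le> (w m - w n) * B" .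
  moreover have "norm (w n *\<^sub>R A n) \<le> w n * B"
    using nonneg bound [OF \<open>m \<le> n\<close>] by (auto simp: A_def intro!: mult_left_mono)
  ultimately have "norm (\<Sum>i\<in>{m..<n}. w i *\<^sub>R a i) \<le> w n * B + (w m - w n) * B"
    unfolding parts by (intro order.trans [OF norm_triangle_ineq] add_mono)
  thus ?thesis by (simp add: algebra_simps)
qed

lemma uniformly_convergent_onI_blocks:
  fixes f :: "nat \<Rightarrow> 'x \<Rightarrow> 'a::banach"
  assumes "\<And>e. 0 < e \<Longrightarrow> \<exists>M. \<forall>m\<ge>M. \<forall>n\<ge>m. \<forall>x\<in>X. norm (\<Sum>i\<in>{m..<n}. f i x) < e"
  shows "uniformly_convergent_on X (\<lambda>n x. \<Sum>i<n. f i x)"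
proof (rule Cauchy_uniformly_convergent, unfold uniformly_Cauchy_on_def, intro allI impI)
  fix e :: real assume "0 < e"
  then obtain M where M: "\<forall>m\<ge>M. \<forall>n\<ge>m. \<forall>x\<in>X. norm (\<Sum>i\<in>{m..<n}. f i x) < e"
    using assms by blast
  have diff: "(\<Sum>i<n. f i x) - (\<Sum>i<m. f i x) = (\<Sum>i\<in>{m..<n}. f i x)" if "m \<le> n" for m n x
    using sum_diff_nat_ivl [of 0 m n "\<lambda>i. f i x"] that by (simp add: atLeast0LessThan)
  show "\<exists>M. \<forall>x\<in>X. \<forall>m\<ge>M. \<forall>n\<ge>M. dist (\<Sum>i<m. f i x) (\<Sum>i<n. f i x) < e"
  proof (intro exI [of _ M] ballI allI impI)
    fix x m n assume *: "x \<in> X" "M \<le> m" "M \<le> n"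
    show "dist (\<Sum>i<m. f i x) (\<Sum>i<n. f i x) < e"
    proof (cases "m \<le> n")
      case True
      then show ?thesis
        unfolding dist_norm norm_minus_commute [of "\<Sum>i<m. f i x"] diff [OF True] using M * by blast
    next
      case False
      then have "n \<le> m" by simp
      then show ?thesis
        unfolding dist_norm diff [OF \<open>n \<le> m\<close>] using M * by blast
    qed
  qed
qed

text \<open>
  Abel's limit theorem for an arbitrary family of decreasing weights that tends to
  \<open>1\<close> termwise: the blocks of the weighted series are dominated uniformly in \<open>j\<close> by blocks of the
  original one, so the two limits can be interchanged. It is used with the powers \<open>r ^ k\<close> for
  \<open>r\<close> tending to \<open>1\<close>, and with the weights \<open>(1 - exp (- t)) / t\<close> that come from Gaussian averages.
\<close>

lemma abel_limit:
  fixes a :: "nat \<Rightarrow> 'a::banach" and w :: "nat \<Rightarrow> nat \<Rightarrow> real"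
  assumes "a sums s" and dec: "\<And>j k. w j (Suc k) \<le> w j k" and nonneg: "\<And>j k. 0 \<le> w j k"
    and le1: "\<And>j. w j 0 \<le> 1" and lim: "\<And>k. (\<lambda>j. w j k) \<longlonglongrightarrow> 1"
  shows "(\<lambda>j. \<Sum>k. w j k *\<^sub>R a k) \<longlonglongrightarrow> s"
proof -
  have "uniformly_convergent_on UNIV (\<lambda>n j. \<Sum>k<n. w j k *\<^sub>R a k)"
  proof (rule uniformly_convergent_onI_blocks)
    fix e :: real assume "0 < e"
    then obtain M where M: "\<And>m n. m \<ge> M \<Longrightarrow> norm (\<Sum>i\<in>{m..<n}. a i) < e / 2"
      using sums_summable [OF \<open>a sums s\<close>] half_gt_zero unfolding summable_Cauchy by metis
    show "\<exists>M. \<forall>m\<ge>M. \<forall>n\<ge>m. \<forall>j\<in>UNIV. norm (\<Sum>k\<in>{m..<n}. w j k *\<^sub>R a k) < e"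
    proof (intro exI [of _ M] allI impI ballI)
      fix m n j :: nat assume mn: "M \<le> m" "m \<le> n"
      have "norm (\<Sum>k\<in>{m..<n}. w j k *\<^sub>R a k) \<le> e / 2 * w j m"
        using M mn by (intro norm_weighted_sum_le dec nonneg) (auto intro: less_imp_le)
      also have "w j m \<le> 1"
        using lift_Suc_antimono_le [of "w j" 0 m] dec le1 [of j] by (meson order.trans zero_le)
      finally show "norm (\<Sum>k\<in>{m..<n}. w j k *\<^sub>R a k) < e"
        using \<open>0 < e\<close> by simp
    qed
  qed
  then have unif: "uniform_limit UNIV (\<lambda>n j. \<Sum>k<n. w j k *\<^sub>R a k)
      (\<lambda>j. \<Sum>k. w j k *\<^sub>R a k) sequentially"
    by (simp add: uniformly_convergent_uniform_limit_iff suminf_eq_lim)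
  have "(\<lambda>j. \<Sum>k<n. w j k *\<^sub>R a k) \<longlonglongrightarrow> (\<Sum>k<n. 1 *\<^sub>R a k)" for n
    by (intro tendsto_sum tendsto_scaleR lim tendsto_const)
  then have finite: "(\<lambda>j. \<Sum>k<n. w j k *\<^sub>R a k) \<longlonglongrightarrow> (\<Sum>k<n. a k)" for n
    by simp
  show ?thesis
    by (rule swap_uniform_limit' [OF always_eventually [OF allI [OF finite]]
          \<open>a sums s\<close> [unfolded sums_def] unif]) simp_all
qed

section \<open>Characters of the circle and their Gaussian averages\<close>

definition fourier_char :: "int \<Rightarrow> real \<Rightarrow> complex" where
  "fourier_char k x = cis (2 * pi * of_int k * x)"

lemma fourier_char_eq_exp:
  "exp (2 * of_real pi * \<i> * of_int k * of_real x) = fourier_char k x"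
  by (simp add: fourier_char_def cis_conv_exp mult_ac)

lemma norm_fourier_char [simp]: "norm (fourier_char k x) = 1"
  by (simp add: fourier_char_def)

lemma fourier_char_0 [simp]: "fourier_char 0 x = 1" "fourier_char k 0 = 1"
  by (simp_all add: fourier_char_def)

lemma fourier_char_add: "fourier_char k (x + y) = fourier_char k x * fourier_char k y"
  by (simp add: fourier_char_def cis_mult algebra_simps)

lemma fourier_char_add_index: "fourier_char (k + l) x = fourier_char k x * fourier_char l x"
  by (simp add: fourier_char_def cis_mult algebra_simps)

lemma fourier_char_uminus: "fourier_char (- k) x = cnj (fourier_char k x)"
  by (simp add: fourier_char_def cis_cnj)

lemma fourier_char_minus: "fourier_char k (- x) = fourier_char (- k) x"
  by (simp add: fourier_char_def)

lemma fourier_char_mult: "fourier_char k (real a * x) = fourier_char (int a * k) x"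
  by (simp add: fourier_char_def mult_ac)

lemma fourier_char_of_int [simp]: "fourier_char k (of_int m) = 1"
  using cis_multiple_2pi [of "of_int (k * m)"] by (simp add: fourier_char_def mult_ac)

lemma fourier_char_Ints: "x \<in> \<int> \<Longrightarrow> fourier_char k x = 1"
  by (auto elim: Ints_cases)

lemma fourier_char_frac: "fourier_char k (frac x) = fourier_char k x"
  using fourier_char_add [of k "frac x" "of_int \<lfloor>x\<rfloor>"] by (simp add: frac_def)

lemma fourier_char_power: "fourier_char (int k) x = fourier_char 1 x ^ k"
  by (simp add: fourier_char_def Complex.DeMoivre mult_ac)

lemma fourier_char_eq_1_iff: "fourier_char 1 x = 1 \<longleftrightarrow> x \<in> \<int>"
proof
  assume "fourier_char 1 x = 1"
  then have "cos (2 * pi * x) = 1"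
    by (simp add: fourier_char_def cis.ctr complex_eq_iff)
  then obtain m :: int where "2 * pi * x = of_int m * (2 * pi)"
    by (auto simp: cos_one_2pi_int)
  then have "x = of_int m" by simp
  then show "x \<in> \<int>" by simp
qed (rule fourier_char_Ints)

lemma continuous_on_fourier_char [continuous_intros]: "continuous_on A (fourier_char k)"
  unfolding fourier_char_def cis_conv_exp by (intro continuous_intros)

lemma borel_measurable_fourier_char [measurable]: "fourier_char k \<in> borel_measurable borel"
  by (intro borel_measurable_continuous_onI continuous_on_fourier_char)

interpretation std_normal: real_distribution std_normal_distribution
  by (rule real_dist_normal_dist)

lemma integrable_fourier_char:
  "integrable std_normal_distribution (\<lambda>z. fourier_char k (x + \<sigma> * z))"
  by (rule std_normal.integrable_const_bound [of _ 1]) auto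

text \<open>
  This is the characteristic function of the normal distribution. Averaging \<open>F\<close> over
  \<open>x + \<sigma> * z\<close> hence multiplies its Fourier coefficients by Gaussian weights, while positivity of the
  averaging keeps the result below the maximum of \<open>F\<close>.
\<close>

lemma expectation_fourier_char:
  "(\<integral>z. fourier_char k (x + \<sigma> * z) \<partial>std_normal_distribution)
     = exp (- (2 * pi * of_int k * \<sigma>)\<^sup>2 / 2) *\<^sub>R fourier_char k x"
proof -
  have eq: "fourier_char k (x + \<sigma> * z) = fourier_char k x * iexp ((2 * pi * of_int k * \<sigma>) * z)" for z
    unfolding fourier_char_add by (simp add: fourier_char_def cis_conv_exp mult_ac)
  show ?thesis
    using fun_cong [OF char_std_normal_distribution, of "2 * pi * of_int k * \<sigma>"]
    unfolding eq char_def by (simp add: scaleR_conv_of_real mult_ac)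
qed

text \<open>
  The function \<open>(1 - exp (- t)) / t\<close> decreases from \<open>1\<close>. This monotonicity
  makes the weights of the next section admissible in the limit theorem for decreasing weights.
\<close>

lemma gaussian_quotient_antimono:
  assumes "0 < s" "s \<le> t"
  shows "(1 - exp (- t)) / t \<le> (1 - exp (- s)) / (s::real)"
proof (rule DERIV_nonpos_imp_nonincreasing [OF \<open>s \<le> t\<close>], intro exI conjI)
  fix u assume "s \<le> u" "u \<le> t"
  then have "0 < u" using \<open>0 < s\<close> by simp
  then show "((\<lambda>u. (1 - exp (- u)) / u) has_real_derivative (exp (- u) * u - (1 - exp (- u))) / u\<^sup>2) (at u)"
    by (auto intro!: derivative_eq_intros simp: power2_eq_square)
  have "(u + 1) * exp (- u) \<le> exp u * exp (- u)"
    using exp_ge_add_one_self [of u] by (intro mult_right_mono) (auto simp: add.commute)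
  then show "(exp (- u) * u - (1 - exp (- u))) / u\<^sup>2 \<le> 0"
    by (intro divide_nonpos_nonneg) (auto simp: algebra_simps exp_minus)
qed

lemma gaussian_quotient_le_1:
  assumes "0 < (t::real)" shows "(1 - exp (- t)) / t \<le> 1"
  using assms exp_ge_add_one_self [of "- t"] by simp

lemma gaussian_quotient_tendsto:
  assumes "0 < (c::real)" 
  shows "(\<lambda>j. (1 - exp (- (c / real (Suc j)))) / (c / real (Suc j))) \<longlonglongrightarrow> 1"
proof -
  have "((\<lambda>u::real. (1 - exp (- u)) / u) \<longlongrightarrow> 1) (at_right 0)"
    by real_asymp
  moreover have "filterlim (\<lambda>j. c / real (Suc j)) (at_right 0) sequentially"
    using assms by real_asymp
  ultimately show ?thesis by (rule filterlim_compose)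
qed

section \<open>Uniqueness of trigonometric series\<close>

lemma summable_inverse_squares_Suc: "summable (\<lambda>k. C / real (Suc k) ^ 2)"
proof -
  have "summable (\<lambda>k. inverse (real (Suc k) ^ 2))"
    using inverse_power_summable [of 2, where 'a = real] by (subst summable_Suc_iff) simp
  from summable_mult [OF this, of C] show ?thesis by (simp add: divide_inverse)
qed

text \<open>
  The core of the uniqueness theorem. Formally integrating twice gives (up to sign and scale) the
  continuous periodic function \<open>F x = (\<Sum>k\<ge>1. a k x / k\<^sup>2)\<close>, where \<open>a k x\<close> is the \<open>k\<close>-th term of
  the given series. At a maximum \<open>x0\<close> of \<open>F\<close> a Gaussian average of \<open>F\<close> cannot exceed
  \<open>F x0\<close>. After division by \<open>\<lambda> = 2 * (pi * \<sigma>)\<^sup>2\<close> this says that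
  \<open>(\<Sum>k\<ge>1. a k x0 * (1 - exp (- \<lambda> * k\<^sup>2)) / (\<lambda> * k\<^sup>2)) \<ge> 0\<close>. The weights decrease in \<open>k\<close>
  and tend to \<open>1\<close> as \<open>\<lambda> \<rightarrow> 0\<close>, so the sum of the series at \<open>x0\<close> is nonnegative too. Compared with
  Riemann's symmetric second differences, whose weights \<open>(sin u / u)\<^sup>2\<close> oscillate, the Gaussian
  leaves no total variation to be estimated.
\<close>

lemma constant_trig_series_nonneg:
  fixes v :: "nat \<Rightarrow> complex"
  assumes bound: "\<And>k. norm (v k) \<le> C"
    and sums: "\<And>x. (\<lambda>k. Re (v k * fourier_char (int (Suc k)) x)) sums s"
  shows "0 \<le> s"
proof -
  define a where "a k x = Re (v k * fourier_char (int (Suc k)) x)" for k x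
  define F where "F x = (\<Sum>k. a k x / real (Suc k) ^ 2)" for x
  have a_le: "\<bar>a k x\<bar> \<le> C" for k x
    unfolding a_def using abs_Re_le_cmod [of "v k * fourier_char (int (Suc k)) x"] bound [of k]
    by (simp add: norm_mult)
  have unif: "uniform_limit UNIV (\<lambda>N x. \<Sum>k<N. a k x / real (Suc k) ^ 2) F sequentially"
    unfolding F_def
    by (rule Weierstrass_m_test [OF _ summable_inverse_squares_Suc [of C]])
      (use a_le in \<open>auto intro!: divide_right_mono\<close>)
  have F_sums: "(\<lambda>k. a k x / real (Suc k) ^ 2) sums F x" for x
    using tendsto_uniform_limitI [OF unif, of x] by (simp add: sums_def)

  \<comment> \<open>\<open>F\<close> is continuous and periodic, so it has a global maximum.\<close>
  have "continuous_on {0..1} (\<lambda>x. a k x)" for k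
    unfolding a_def by (intro continuous_intros)
  then have "continuous_on {0..1} F"
    by (intro uniform_limit_theorem [OF _ uniform_limit_on_subset [OF unif]] always_eventually
        allI continuous_on_sum continuous_on_divide continuous_intros) auto
  then obtain x0 where "x0 \<in> {0..1}" and x0: "\<And>y. y \<in> {0..1} \<Longrightarrow> F y \<le> F x0"
    using continuous_attains_sup [of "{0..1::real}" F] by auto
  have "a k (frac y) = a k y" for k y
    by (simp add: a_def fourier_char_frac)
  then have "F (frac y) = F y" for y
    by (simp add: F_def)
  then have max: "F y \<le> F x0" for y
    using x0 [of "frac y"] frac_ge_0 [of y] frac_lt_1 [of y] by simp

  \<comment> \<open>The exponent that the average with \<open>\<sigma>\<^sup>2 = 1 / Suc j\<close> produces at frequency \<open>Suc k\<close>.\<close>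
  define t where "t j k = 2 * pi\<^sup>2 / real (Suc j) * real (Suc k) ^ 2" for j k
  have t_pos: "0 < t j k" for j k
    by (simp add: t_def)
  have avg: "integrable std_normal_distribution (\<lambda>z. a k (x0 + \<sigma> * z))"
    "(\<integral>z. a k (x0 + \<sigma> * z) \<partial>std_normal_distribution)
      = exp (- (2 * pi * real (Suc k) * \<sigma>)\<^sup>2 / 2) * a k x0" for k \<sigma>
  proof -
    have int: "integrable std_normal_distribution (\<lambda>z. v k * fourier_char (int (Suc k)) (x0 + \<sigma> * z))"
      by (rule integrable_mult_right) (rule integrable_fourier_char)
    show "integrable std_normal_distribution (\<lambda>z. a k (x0 + \<sigma> * z))"
      unfolding a_def by (rule integrable_Re [OF int])
    have "(\<integral>z. a k (x0 + \<sigma> * z) \<partial>std_normal_distribution)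
        = Re (v k * (exp (- (2 * pi * of_int (int (Suc k)) * \<sigma>)\<^sup>2 / 2) *\<^sub>R fourier_char (int (Suc k)) x0))"
      unfolding a_def by (simp only: integral_Re [OF int] integral_mult_right_zero expectation_fourier_char)
    then show "(\<integral>z. a k (x0 + \<sigma> * z) \<partial>std_normal_distribution)
      = exp (- (2 * pi * real (Suc k) * \<sigma>)\<^sup>2 / 2) * a k x0"
      by (simp only: a_def mult_scaleR_right scaleR_complex.sel of_int_of_nat_eq)
  qed
  \<comment> \<open>The partial sums approximate \<open>F\<close> uniformly and are averaged exactly, so no interchange of
    integral and series is needed.\<close>
  have smooth_le: "(\<lambda>k. a k x0 / real (Suc k) ^ 2 * exp (- t j k)) sums S \<Longrightarrow> S \<le> F x0" for j S
  proof -
    assume S: "(\<lambda>k. a k x0 / real (Suc k) ^ 2 * exp (- t j k)) sums S"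
    define \<sigma> where "\<sigma> = sqrt (1 / real (Suc j))"
    have \<sigma>: "- (2 * pi * real (Suc k) * \<sigma>)\<^sup>2 / 2 = - t j k" for k
      by (simp add: \<sigma>_def t_def power_mult_distrib divide_simps)
    have "S \<le> F x0 + \<delta>" if "0 < \<delta>" for \<delta>
    proof (rule tendsto_upperbound [OF S [unfolded sums_def]])
      have "\<forall>\<^sub>F N in sequentially. \<forall>y\<in>UNIV. dist (\<Sum>k<N. a k y / real (Suc k) ^ 2) (F y) < \<delta>"
        using unif \<open>0 < \<delta>\<close> by (simp add: uniform_limit_iff)
      then show "\<forall>\<^sub>F N in sequentially. (\<Sum>k<N. a k x0 / real (Suc k) ^ 2 * exp (- t j k)) \<le> F x0 + \<delta>"
      proof eventually_elim
        case (elim N)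
        have "(\<integral>z. (\<Sum>k<N. a k (x0 + \<sigma> * z) / real (Suc k) ^ 2) \<partial>std_normal_distribution)
            = (\<Sum>k<N. \<integral>z. a k (x0 + \<sigma> * z) / real (Suc k) ^ 2 \<partial>std_normal_distribution)"
          by (intro Bochner_Integration.integral_sum integrable_divide avg)
        also have "\<dots> = (\<Sum>k<N. a k x0 / real (Suc k) ^ 2 * exp (- t j k))"
          by (simp only: integral_divide_zero avg(2) \<sigma>) (simp add: mult.commute)
        finally have "(\<Sum>k<N. a k x0 / real (Suc k) ^ 2 * exp (- t j k))
            = (\<integral>z. (\<Sum>k<N. a k (x0 + \<sigma> * z) / real (Suc k) ^ 2) \<partial>std_normal_distribution)" ..
        also have "\<dots> \<le> (\<integral>z. F x0 + \<delta> \<partial>std_normal_distribution)"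
        proof (rule integral_mono)
          fix z
          have "(\<Sum>k<N. a k (x0 + \<sigma> * z) / real (Suc k) ^ 2) \<le> F (x0 + \<sigma> * z) + \<delta>"
            using elim [rule_format, of "x0 + \<sigma> * z"] by (simp add: dist_real_def)
          also have "\<dots> \<le> F x0 + \<delta>"
            using max by simp
          finally show "(\<Sum>k<N. a k (x0 + \<sigma> * z) / real (Suc k) ^ 2) \<le> F x0 + \<delta>" .
        qed (auto intro!: avg Bochner_Integration.integrable_sum)
        also have "\<dots> = F x0 + \<delta>"
          using std_normal.prob_space by simp
        finally show ?case .
      qed
    qed simp
    then show "S \<le> F x0"
      by (rule field_le_epsilon)
  qed

  define w where "w j k = (1 - exp (- t j k)) / t j k" for j k
  have w_nonneg: "0 \<le> w j k" for j k
    unfolding w_def using t_pos [of j k] by simp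
  have w_dec: "w j (Suc k) \<le> w j k" for j k
    unfolding w_def using t_pos
    by (intro gaussian_quotient_antimono) (auto simp: t_def intro!: divide_right_mono mult_left_mono power_mono)
  have w_le: "w j k \<le> 1" for j k
    unfolding w_def by (intro gaussian_quotient_le_1 t_pos)
  have w_lim: "(\<lambda>j. w j k) \<longlonglongrightarrow> 1" for k
    using gaussian_quotient_tendsto [of "2 * pi\<^sup>2 * real (Suc k) ^ 2"] by (simp add: w_def t_def)
  have "(\<lambda>j. \<Sum>k. w j k *\<^sub>R a k x0) \<longlonglongrightarrow> s"
    by (rule abel_limit) (use sums in \<open>auto simp: a_def w_nonneg w_dec w_le w_lim\<close>)
  moreover have "0 \<le> (\<Sum>k. w j k *\<^sub>R a k x0)" for j
  proof -
    have "summable (\<lambda>k. a k x0 / real (Suc k) ^ 2 * exp (- t j k))"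
      by (rule summable_comparison_test' [OF summable_inverse_squares_Suc [of C], of 0])
        (use a_le less_imp_le [OF t_pos] in \<open>auto simp: abs_mult intro!: divide_right_mono mult_mono [of _ C _ 1, simplified] order.trans [OF mult_left_le]\<close>)
    then obtain S where S: "(\<lambda>k. a k x0 / real (Suc k) ^ 2 * exp (- t j k)) sums S"
      by (auto simp: summable_def)
    have "(\<lambda>k. real (Suc j) / (2 * pi\<^sup>2) * (a k x0 / real (Suc k) ^ 2 - a k x0 / real (Suc k) ^ 2 * exp (- t j k)))
        sums (real (Suc j) / (2 * pi\<^sup>2) * (F x0 - S))"
      by (intro sums_mult sums_diff F_sums S)
    also have "(\<lambda>k. real (Suc j) / (2 * pi\<^sup>2) * (a k x0 / real (Suc k) ^ 2 - a k x0 / real (Suc k) ^ 2 * exp (- t j k)))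
        = (\<lambda>k. w j k *\<^sub>R a k x0)"
      by (auto simp: w_def t_def field_simps)
    finally have "(\<Sum>k. w j k *\<^sub>R a k x0) = real (Suc j) / (2 * pi\<^sup>2) * (F x0 - S)"
      by (rule sums_unique [symmetric])
    then show ?thesis
      using smooth_le [OF S] by simp
  qed
  ultimately show "0 \<le> s"
    by (intro LIMSEQ_le_const) auto
qed

definition sym_sum :: "(int \<Rightarrow> complex) \<Rightarrow> nat \<Rightarrow> real \<Rightarrow> complex" where
  "sym_sum c N x = (\<Sum>k\<in>{- int N..int N}. c k * fourier_char k x)"

lemma sym_sum_0 [simp]: "sym_sum c 0 x = c 0"
  by (simp add: sym_sum_def)

lemma sym_sum_Suc:
  "sym_sum c (Suc N) x = sym_sum c N x + c (int (Suc N)) * fourier_char (int (Suc N)) x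
     + c (- int (Suc N)) * fourier_char (- int (Suc N)) x"
proof -
  have "{- int (Suc N)..int (Suc N)} = insert (int (Suc N)) (insert (- int (Suc N)) {- int N..int N})"
    by auto
  then show ?thesis by (simp add: sym_sum_def)
qed

lemma sym_sum_eq_sum:
  "sym_sum c N x = c 0 + (\<Sum>k<N. c (int (Suc k)) * fourier_char (int (Suc k)) x
     + c (- int (Suc k)) * fourier_char (- int (Suc k)) x)"
  by (induction N) (simp_all add: sym_sum_Suc add.assoc del: of_nat_Suc)

lemma sym_sum_cmult: "sym_sum (\<lambda>k. u * c k) N x = u * sym_sum c N x"
  by (simp add: sym_sum_def sum_distrib_left mult.assoc)

lemma sym_sum_diff: "sym_sum (\<lambda>k. c k - d k) N x = sym_sum c N x - sym_sum d N x"
  by (simp add: sym_sum_def sum_subtractf algebra_simps)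

lemma sym_sum_reflect: "sym_sum (\<lambda>k. c (- k)) N x = sym_sum c N (- x)"
  by (induction N) (simp_all add: sym_sum_Suc fourier_char_minus del: of_nat_Suc)

text \<open>
  Multiplying a series by a character shifts its coefficients; for symmetric partial sums two
  boundary terms remain, which is why coefficients tending to \<open>0\<close> are required below.
\<close>

lemma sym_sum_shift:
  "sym_sum (\<lambda>k. c (k + 1)) N x = fourier_char (- 1) x *
     (sym_sum c N x - c (- int N) * fourier_char (- int N) x + c (int N + 1) * fourier_char (int N + 1) x)"
proof (induction N)
  case 0
  show ?case by (simp flip: fourier_char_add_index)
next
  case (Suc N)
  have up: "fourier_char (- 1) x * fourier_char (int (Suc N) + 1) x = fourier_char (int (Suc N)) x"
    by (simp flip: fourier_char_add_index)
  have down: "fourier_char (- 1) x * fourier_char (- int N) x = fourier_char (- int (Suc N)) x"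
    by (simp flip: fourier_char_add_index)
  have "fourier_char (- 1) x * (c (- int N) * fourier_char (- int N) x
          + c (int (Suc N) + 1) * fourier_char (int (Suc N) + 1) x)
      = c (int (Suc N) + 1) * fourier_char (int (Suc N)) x + c (- int N) * fourier_char (- int (Suc N)) x"
    unfolding up [symmetric] down [symmetric] by (simp add: algebra_simps)
  then show ?case
    unfolding sym_sum_Suc Suc.IH by (simp add: algebra_simps)
qed

text \<open>
  If the series sums to \<open>0\<close> everywhere, then the part without the constant term has the constant
  sum \<open>- c 0\<close>.
\<close>

lemma Re_zeroth_coeff_le_0:
  assumes bound: "\<And>k. norm (c k) \<le> C" and lim: "\<And>x. (\<lambda>N. sym_sum c N x) \<longlonglongrightarrow> 0"
  shows "Re (c 0) \<le> 0"
proof -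
  define v where "v k = c (int (Suc k)) + cnj (c (- int (Suc k)))" for k
  have "0 \<le> - Re (c 0)"
  proof (rule constant_trig_series_nonneg)
    show "norm (v k) \<le> C + C" for k
      unfolding v_def using bound by (intro norm_triangle_mono) auto
    fix x
    have "Re (v k * fourier_char (int (Suc k)) x)
        = Re (c (int (Suc k)) * fourier_char (int (Suc k)) x
            + c (- int (Suc k)) * fourier_char (- int (Suc k)) x)" for k
      by (simp add: v_def fourier_char_uminus algebra_simps del: of_nat_Suc)
    then have "(\<Sum>k<N. Re (v k * fourier_char (int (Suc k)) x)) = Re (sym_sum c N x) - Re (c 0)" for N
      unfolding sym_sum_eq_sum by (simp del: of_nat_Suc)
    moreover have "(\<lambda>N. Re (sym_sum c N x) - Re (c 0)) \<longlonglongrightarrow> Re 0 - Re (c 0)"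
      by (intro tendsto_intros lim)
    ultimately show "(\<lambda>k. Re (v k * fourier_char (int (Suc k)) x)) sums - Re (c 0)"
      by (simp add: sums_def)
  qed
  then show ?thesis by simp
qed

text \<open>
  Multiplication by \<open>- 1\<close> and \<open>\<plusminus> \<i>\<close> turns the one-sided bound for the real part into equality.
\<close>

lemma zeroth_coeff_eq_0:
  assumes bound: "\<And>k. norm (c k) \<le> C" and lim: "\<And>x. (\<lambda>N. sym_sum c N x) \<longlonglongrightarrow> 0"
  shows "c 0 = 0"
proof -
  have rotated: "Re (u * c 0) \<le> 0" if "norm u = 1" for u
  proof (rule Re_zeroth_coeff_le_0 [of "\<lambda>k. u * c k"])
    show "norm (u * c k) \<le> C" for k
      using bound that by (simp add: norm_mult)
    show "(\<lambda>N. sym_sum (\<lambda>k. u * c k) N x) \<longlonglongrightarrow> 0" for x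
      unfolding sym_sum_cmult using tendsto_mult_left [OF lim, of u] by simp
  qed
  show ?thesis
    using rotated [of 1] rotated [of "- 1"] rotated [of \<i>] rotated [of "- \<i>"]
    by (simp add: complex_eq_iff)
qed

definition vanishing_at_infinity :: "(int \<Rightarrow> complex) \<Rightarrow> bool" where
  "vanishing_at_infinity c \<longleftrightarrow> (\<lambda>N. c (int N)) \<longlonglongrightarrow> 0 \<and> (\<lambda>N. c (- int N)) \<longlonglongrightarrow> 0"

lemma vanishing_bounded:
  assumes "vanishing_at_infinity c"
  obtains C where "\<And>k. norm (c k) \<le> C"
proof -
  have "Bseq (\<lambda>N. c (int N))" "Bseq (\<lambda>N. c (- int N))"
    using assms by (auto simp: vanishing_at_infinity_def intro!: convergent_imp_Bseq convergentI)
  then obtain A B where A: "\<And>N. norm (c (int N)) \<le> A" and B: "\<And>N. norm (c (- int N)) \<le> B"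
    by (auto elim!: BseqE)
  have "norm (c k) \<le> max A B" for k
    using A [of "nat k"] B [of "nat (- k)"] by (cases "0 \<le> k") auto
  then show ?thesis by (rule that)
qed

lemma vanishing_shift:
  assumes "vanishing_at_infinity c"
  shows "vanishing_at_infinity (\<lambda>k. c (k + 1))"
  unfolding vanishing_at_infinity_def
proof
  show "(\<lambda>N. c (int N + 1)) \<longlonglongrightarrow> 0"
    using LIMSEQ_Suc [of "\<lambda>N. c (int N)"] assms by (simp add: vanishing_at_infinity_def add.commute)
  show "(\<lambda>N. c (- int N + 1)) \<longlonglongrightarrow> 0"
    by (rule LIMSEQ_imp_Suc) (use assms in \<open>simp add: vanishing_at_infinity_def\<close>)
qed

lemma vanishing_diff:
  "vanishing_at_infinity c \<Longrightarrow> vanishing_at_infinity d \<Longrightarrow> vanishing_at_infinity (\<lambda>k. c k - d k)"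
  unfolding vanishing_at_infinity_def using tendsto_diff [where a = 0 and b = "0::complex"] by fastforce

lemma unimodular_mult_tendsto_0:
  assumes "a \<longlonglongrightarrow> 0" and "\<And>N. norm (u N) = (1::real)"
  shows "(\<lambda>N. a N * u N :: complex) \<longlonglongrightarrow> 0"
  using assms by (intro tendsto_norm_zero_cancel [of "\<lambda>N. a N * u N"]) (simp add: norm_mult tendsto_norm_zero)

lemma sym_sum_shift_tendsto:
  assumes van: "vanishing_at_infinity c" and lim: "(\<lambda>N. sym_sum c N x) \<longlonglongrightarrow> L"
  shows "(\<lambda>N. sym_sum (\<lambda>k. c (k + 1)) N x) \<longlonglongrightarrow> fourier_char (- 1) x * L"
proof -
  have "(\<lambda>N. c (- int N) * fourier_char (- int N) x) \<longlonglongrightarrow> 0"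
    "(\<lambda>N. c (int N + 1) * fourier_char (int N + 1) x) \<longlonglongrightarrow> 0"
    using van vanishing_shift [OF van]
    by (auto simp: vanishing_at_infinity_def intro!: unimodular_mult_tendsto_0)
  then have "(\<lambda>N. sym_sum (\<lambda>k. c (k + 1)) N x) \<longlonglongrightarrow> fourier_char (- 1) x * (L - 0 + 0)"
    unfolding sym_sum_shift by (intro tendsto_intros lim)
  then show ?thesis by simp
qed

text \<open>
  Cantor's uniqueness theorem: each coefficient can be shifted into the zeroth position.
\<close>

theorem trig_series_uniqueness_everywhere:
  assumes van: "vanishing_at_infinity c" and lim: "\<And>x. (\<lambda>N. sym_sum c N x) \<longlonglongrightarrow> 0"
  shows "c k = 0"
proof -
  have nonneg_index: "c (int m) = 0"
    if "vanishing_at_infinity c" "\<And>x. (\<lambda>N. sym_sum c N x) \<longlonglongrightarrow> 0" for c m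
    using that
  proof (induction m arbitrary: c)
    case 0
    then show ?case using vanishing_bounded zeroth_coeff_eq_0 by (metis of_nat_0)
  next
    case (Suc m)
    from Suc.prems have "(\<lambda>N. sym_sum (\<lambda>k. c (k + 1)) N x) \<longlonglongrightarrow> 0" for x
      using sym_sum_shift_tendsto [of c x 0] by simp
    with Suc.IH [of "\<lambda>k. c (k + 1)"] vanishing_shift Suc.prems(1) show ?case
      by (simp add: add.commute)
  qed
  show ?thesis
  proof (cases "0 \<le> k")
    case True
    then show ?thesis using nonneg_index [of c "nat k", OF van lim] by simp
  next
    case False
    have "vanishing_at_infinity (\<lambda>k. c (- k))"
      using van by (simp add: vanishing_at_infinity_def)
    moreover have "(\<lambda>N. sym_sum (\<lambda>k. c (- k)) N x) \<longlonglongrightarrow> 0" for x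
      by (simp add: sym_sum_reflect lim)
    ultimately show ?thesis
      using nonneg_index [of "\<lambda>k. c (- k)" "nat (- k)"] False by simp
  qed
qed

text \<open>
  The Cantor-Lebesgue lemma. The terms \<open>p k * e k + q k * e (- k)\<close> of the series tend to \<open>0\<close> almost
  everywhere, whereas the mean of \<open>\<bar>p k * e k + q k * e (- k)\<bar>\<^sup>2\<close> is comparable to
  \<open>(max \<bar>p k\<bar> \<bar>q k\<bar>)\<^sup>2\<close>. Dividing by \<open>max \<epsilon> \<bar>p k\<bar> \<bar>q k\<bar>\<close> makes the terms bounded, and then dominated
  convergence forbids that this maximum is at least \<open>\<epsilon>\<close> infinitely often. The mean is taken with
  respect to the normal distribution, for which the cross term is small because
  the characteristic function decays.
\<close>

lemma coeffs_vanish_of_convergence: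
  assumes "\<And>x. x \<notin> \<int> \<Longrightarrow> convergent (\<lambda>N. sym_sum c N x)"
  shows "vanishing_at_infinity c"
proof -
  define p q where "p k = c (int (Suc k))" and "q k = c (- int (Suc k))" for k
  define M where "M k = max (norm (p k)) (norm (q k))" for k
  have terms: "(\<lambda>k. p k * fourier_char (int (Suc k)) x + q k * fourier_char (- int (Suc k)) x) \<longlonglongrightarrow> 0"
    if x: "x \<notin> \<int>" for x
  proof -
    obtain L where L: "(\<lambda>N. sym_sum c N x) \<longlonglongrightarrow> L"
      using assms [OF x] by (auto simp: convergent_def)
    have "(\<lambda>N. sym_sum c (Suc N) x - sym_sum c N x) \<longlonglongrightarrow> L - L"
      by (intro tendsto_diff LIMSEQ_Suc L)
    then show ?thesis by (simp add: sym_sum_Suc p_def q_def add.assoc del: of_nat_Suc)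
  qed
  have "M \<longlonglongrightarrow> 0"
  proof (rule LIMSEQ_I)
    fix \<epsilon> :: real assume "0 < \<epsilon>"
    define h where "h k z = (norm (p k * fourier_char (int (Suc k)) z
        + q k * fourier_char (- int (Suc k)) z) / max \<epsilon> (M k))\<^sup>2" for k z
    have h_le: "h k z \<le> 4" for k z
    proof -
      have "norm (p k * fourier_char (int (Suc k)) z + q k * fourier_char (- int (Suc k)) z)
          \<le> norm (p k) + norm (q k)"
        by (rule order.trans [OF norm_triangle_ineq]) (simp add: norm_mult)
      also have "\<dots> \<le> 2 * max \<epsilon> (M k)"
        by (auto simp: M_def)
      finally have "norm (p k * fourier_char (int (Suc k)) z + q k * fourier_char (- int (Suc k)) z)
          / max \<epsilon> (M k) \<le> 2"
        using \<open>0 < \<epsilon>\<close> by (simp add: pos_divide_le_eq)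
      from power_mono [OF this, of 2] show ?thesis
        unfolding h_def using \<open>0 < \<epsilon>\<close> by simp
    qed
    have h_lim: "(\<lambda>k. h k z) \<longlonglongrightarrow> 0" if "z \<notin> \<int>" for z
    proof -
      have "(\<lambda>k. norm (p k * fourier_char (int (Suc k)) z + q k * fourier_char (- int (Suc k)) z) / \<epsilon>) \<longlonglongrightarrow> 0 / \<epsilon>"
        using \<open>0 < \<epsilon>\<close> by (intro tendsto_divide tendsto_norm_zero terms that tendsto_const) auto
      then have "(\<lambda>k. norm (p k * fourier_char (int (Suc k)) z + q k * fourier_char (- int (Suc k)) z) / \<epsilon>) \<longlonglongrightarrow> 0"
        by simp
      then have "(\<lambda>k. norm (p k * fourier_char (int (Suc k)) z + q k * fourier_char (- int (Suc k)) z)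
          / max \<epsilon> (M k)) \<longlonglongrightarrow> 0"
        by (rule Lim_null_comparison [rotated])
          (use \<open>0 < \<epsilon>\<close> in \<open>auto intro!: divide_left_mono mult_pos_pos always_eventually simp: less_max_iff_disj\<close>)
      from tendsto_power [OF this, of 2] show ?thesis by (simp add: h_def)
    qed
    have "AE z in lborel. z \<notin> (\<int> :: real set)"
      by (intro AE_not_in countable_imp_null_set_lborel countable_int)
    then have "AE z in std_normal_distribution. z \<notin> (\<int> :: real set)"
      by (subst AE_density) auto
    then have "(\<lambda>k. \<integral>z. h k z \<partial>std_normal_distribution) \<longlonglongrightarrow> (\<integral>z. 0 \<partial>std_normal_distribution)"
    proof (intro integral_dominated_convergence [where w = "\<lambda>_. 4"])
      show "AE z in std_normal_distribution. (\<lambda>k. h k z) \<longlonglongrightarrow> 0"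
        if "AE z in std_normal_distribution. z \<notin> (\<int> :: real set)"
        using that by eventually_elim (rule h_lim)
    qed (use h_le in \<open>auto simp: h_def\<close>)
    then have "\<forall>\<^sub>F k in sequentially. (\<integral>z. h k z \<partial>std_normal_distribution) < 1 / 2"
      by (intro order_tendstoD) auto
    moreover have "1 / 2 \<le> (\<integral>z. h k z \<partial>std_normal_distribution)" if "\<epsilon> \<le> M k" for k
    proof -
      define r where "r = exp (- (2 * pi * of_int (2 * int (Suc k)) * 1)\<^sup>2 / 2)"
      have int: "integrable std_normal_distribution
          (\<lambda>z. (p k * cnj (q k)) * fourier_char (2 * int (Suc k)) (0 + 1 * z))"
        by (rule integrable_mult_right) (rule integrable_fourier_char)
      have norm_sq_add: "(norm (x + y))\<^sup>2 = (norm x)\<^sup>2 + (norm y)\<^sup>2 + 2 * Re (x * cnj y)" for x y :: complex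
        unfolding cmod_power2 by (simp add: power2_eq_square algebra_simps)
      have sq: "(norm (p k * fourier_char (int (Suc k)) z + q k * fourier_char (- int (Suc k)) z))\<^sup>2
          = (norm (p k))\<^sup>2 + (norm (q k))\<^sup>2
            + 2 * Re ((p k * cnj (q k)) * fourier_char (2 * int (Suc k)) (0 + 1 * z))" for z
      proof -
        have "fourier_char (2 * int (Suc k)) z = fourier_char (int (Suc k)) z * fourier_char (int (Suc k)) z"
          unfolding mult_2 by (rule fourier_char_add_index)
        then show ?thesis
          unfolding norm_sq_add fourier_char_uminus by (simp add: norm_mult mult_ac del: of_nat_Suc)
      qed
      have "h k z = ((norm (p k))\<^sup>2 + (norm (q k))\<^sup>2
            + 2 * Re ((p k * cnj (q k)) * fourier_char (2 * int (Suc k)) (0 + 1 * z))) / (M k)\<^sup>2" for z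
        unfolding h_def power_divide sq using that by (simp add: max_absorb2)
      then have "(\<integral>z. h k z \<partial>std_normal_distribution)
          = ((norm (p k))\<^sup>2 + (norm (q k))\<^sup>2
             + 2 * (\<integral>z. Re ((p k * cnj (q k)) * fourier_char (2 * int (Suc k)) (0 + 1 * z)) \<partial>std_normal_distribution))
            / (M k)\<^sup>2"
        using std_normal.prob_space
        by (simp only: integral_divide_zero Bochner_Integration.integral_add
            integrable_const std_normal.finite_measure_axioms finite_measure.integrable_const
            integrable_mult_right integrable_Re [OF int] integral_mult_right_zero lebesgue_integral_const
            scaleR_one)
      also have "\<dots> = ((norm (p k))\<^sup>2 + (norm (q k))\<^sup>2 + 2 * Re ((p k * cnj (q k)) * (r *\<^sub>R 1))) / (M k)\<^sup>2"
        by (simp only: integral_Re [OF int] integral_mult_right_zero expectation_fourier_char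
            fourier_char_0 r_def)
      finally have eq: "(\<integral>z. h k z \<partial>std_normal_distribution)
          = ((norm (p k))\<^sup>2 + (norm (q k))\<^sup>2 + 2 * Re ((p k * cnj (q k)) * (r *\<^sub>R 1))) / (M k)\<^sup>2" .
      have "1 * 1 * (1 * 1) \<le> pi * pi * (real (Suc k) * real (Suc k))"
        using pi_ge_two by (intro mult_mono) auto
      then have "3 \<le> (2 * pi * of_int (2 * int (Suc k)) * 1)\<^sup>2 / 2"
        by (simp add: power2_eq_square mult_ac del: of_nat_Suc)
      then have "r \<le> exp (- 3)"
        by (simp add: r_def)
      also have "exp (- 3) \<le> (1 / 4 :: real)"
        using exp_ge_add_one_self [of "3 :: real"] by (simp add: exp_minus field_simps)
      finally have "r \<le> 1 / 4" .
      have "\<bar>Re ((p k * cnj (q k)) * (r *\<^sub>R 1))\<bar> \<le> norm (p k) * norm (q k) * r"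
        using abs_Re_le_cmod [of "(p k * cnj (q k)) * (r *\<^sub>R 1)"]
        by (simp only: norm_mult complex_mod_cnj norm_scaleR norm_one) (simp add: r_def)
      also have "\<dots> \<le> (M k * M k) * (1 / 4)"
        using \<open>r \<le> 1 / 4\<close> by (intro mult_mono) (auto simp: M_def r_def le_max_iff_disj)
      finally have "- (M k * M k) / 4 \<le> Re ((p k * cnj (q k)) * (r *\<^sub>R 1))"
        by simp
      moreover have "M k * M k \<le> (norm (p k))\<^sup>2 + (norm (q k))\<^sup>2"
        unfolding M_def max_def power2_eq_square by simp
      moreover have "0 < M k"
        using that \<open>0 < \<epsilon>\<close> by simp
      ultimately show ?thesis
        unfolding eq by (simp add: pos_le_divide_eq power2_eq_square)
    qed
    ultimately have "\<forall>\<^sub>F k in sequentially. M k < \<epsilon>"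
      by (auto elim!: eventually_mono simp: not_le [symmetric])
    moreover have "norm (M k - 0) = M k" for k
      by (simp add: M_def le_max_iff_disj)
    ultimately show "\<exists>no. \<forall>k\<ge>no. norm (M k - 0) < \<epsilon>"
      by (simp add: eventually_sequentially)
  qed
  then have "p \<longlonglongrightarrow> 0" "q \<longlonglongrightarrow> 0"
    by (auto intro: Lim_null_comparison [of p M] Lim_null_comparison [of q M] simp: M_def)
  then show ?thesis
    unfolding vanishing_at_infinity_def p_def q_def by (auto intro: LIMSEQ_imp_Suc)
qed

text \<open>
  The integers may be exceptional points. Formal multiplication by \<open>e (- 1) - 1\<close>, which vanishes
  exactly there, replaces the coefficients by their differences \<open>c (k + 1) - c k\<close>; off the integers
  the new series still sums to \<open>0\<close>, and at the integers its partial sums telescope to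
  \<open>c (N + 1) - c (- N)\<close>, which also tends to \<open>0\<close>. So \<open>c\<close> is constant, and it tends to \<open>0\<close>.
\<close>

theorem trig_series_uniqueness:
  assumes lim: "\<And>x. x \<notin> \<int> \<Longrightarrow> (\<lambda>N. sym_sum c N x) \<longlonglongrightarrow> 0"
  shows "c k = 0"
proof -
  have van: "vanishing_at_infinity c"
    using lim by (intro coeffs_vanish_of_convergence) (auto simp: convergent_def)
  define d where "d k = c (k + 1) - c k" for k
  have van_d: "vanishing_at_infinity d"
    unfolding d_def by (intro vanishing_diff vanishing_shift van)
  have d_lim: "(\<lambda>N. sym_sum d N x) \<longlonglongrightarrow> 0" for x
  proof (cases "x \<in> \<int>")
    case True
    have "sym_sum d N x = c (int N + 1) - c (- int N)" for N
      unfolding d_def sym_sum_diff sym_sum_shift using True by (simp add: fourier_char_Ints)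
    moreover have "(\<lambda>N. c (int N + 1) - c (- int N)) \<longlonglongrightarrow> 0 - 0"
      using van vanishing_shift [OF van] by (intro tendsto_diff) (auto simp: vanishing_at_infinity_def)
    ultimately show ?thesis by simp
  next
    case False
    have "(\<lambda>N. sym_sum (\<lambda>k. c (k + 1)) N x - sym_sum c N x) \<longlonglongrightarrow> fourier_char (- 1) x * 0 - 0"
      by (intro tendsto_diff sym_sum_shift_tendsto van lim False)
    then show ?thesis unfolding d_def sym_sum_diff by simp
  qed
  have step: "c (k + 1) = c k" for k
    using trig_series_uniqueness_everywhere [OF van_d d_lim, of k] by (simp add: d_def)
  have "c (k + int m) = c k" for m
    using step [of "k + int _"] by (induction m) (simp_all add: ac_simps)
  then have "c (int N) = c k" if "nat k \<le> N" for N
    using that by (metis (no_types) add.commute diff_add_cancel le_diff_eq nat_0_le nat_le_iff of_nat_0_le_iff zero_le_imp_eq_int diff_ge_0_iff_ge)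
  then have "(\<lambda>N. c (int N)) \<longlonglongrightarrow> c k"
    by (intro tendsto_eventually eventually_sequentiallyI [of "nat k"]) auto
  then show ?thesis
    using van LIMSEQ_unique by (auto simp: vanishing_at_infinity_def)
qed

section \<open>The periodic zeta function\<close>

text \<open>
  The real and imaginary parts are the cosine and the sine series of the trigonometric form.
\<close>

definition periodic_zeta :: "nat \<Rightarrow> real \<Rightarrow> complex" where
  "periodic_zeta n x = (\<Sum>k. fourier_char (int (Suc k)) x / of_nat (Suc k) ^ n)"

lemma nonint_unit_interval: "0 < x \<Longrightarrow> x < 1 \<Longrightarrow> (x::real) \<notin> \<int>"
  by (auto elim!: Ints_cases)

lemma norm_sum_fourier_char_le:
  assumes "x \<notin> \<int>"
  shows "norm (\<Sum>k\<in>{m..<N}. fourier_char (int (Suc k)) x) \<le> 2 / norm (1 - fourier_char 1 x)"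
proof (cases "m \<le> N")
  case True
  define z where "z = fourier_char 1 x"
  have nz: "0 < norm (1 - z)"
    using assms by (auto simp: z_def fourier_char_eq_1_iff [symmetric])
  have "(1 - z) * (\<Sum>k\<in>{m..<N}. z ^ Suc k) = z ^ Suc m - z ^ Suc N"
    using True
  proof (induction N rule: dec_induct)
    case (step N)
    have "(\<Sum>k\<in>{m..<Suc N}. z ^ Suc k) = (\<Sum>k\<in>{m..<N}. z ^ Suc k) + z ^ Suc N"
      using step.hyps by (simp del: power_Suc)
    then have "(1 - z) * (\<Sum>k\<in>{m..<Suc N}. z ^ Suc k) = (1 - z) * (\<Sum>k\<in>{m..<N}. z ^ Suc k) + (1 - z) * z ^ Suc N"
      by (simp only: distrib_left)
    also have "(1 - z) * z ^ Suc N = z ^ Suc N - z ^ Suc (Suc N)"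
      by (simp add: algebra_simps)
    finally show ?case
      unfolding step.IH by simp
  qed simp
  then have "norm (1 - z) * norm (\<Sum>k\<in>{m..<N}. z ^ Suc k) = norm (z ^ Suc m - z ^ Suc N)"
    by (metis norm_mult)
  also have "\<dots> \<le> norm (z ^ Suc m) + norm (z ^ Suc N)"
    by (rule norm_triangle_ineq4)
  also have "\<dots> = 2"
    by (simp add: norm_power norm_mult z_def)
  finally have "norm (\<Sum>k\<in>{m..<N}. z ^ Suc k) \<le> 2 / norm (1 - z)"
    using nz by (simp add: pos_le_divide_eq mult.commute)
  then show ?thesis
    unfolding fourier_char_power z_def .
qed simp

text \<open>
  Dirichlet's test in quantitative form. It is uniform away from the integers, which gives not
  only convergence for \<open>n = 1\<close> but also termwise differentiability of the series for \<open>Suc n\<close>.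
\<close>

lemma norm_periodic_zeta_block_le:
  assumes "x \<notin> \<int>" "1 \<le> n" "m \<le> N"
  shows "norm (\<Sum>k\<in>{m..<N}. fourier_char (int (Suc k)) x / of_nat (Suc k) ^ n)
           \<le> 2 / norm (1 - fourier_char 1 x) * (1 / real (Suc m))"
proof -
  have "norm (\<Sum>k\<in>{m..<N}. (1 / real (Suc k) ^ n) *\<^sub>R fourier_char (int (Suc k)) x)
      \<le> 2 / norm (1 - fourier_char 1 x) * (1 / real (Suc m) ^ n)"
    using assms
    by (intro norm_weighted_sum_le norm_sum_fourier_char_le) (auto intro!: divide_left_mono power_mono)
  also have "\<dots> \<le> 2 / norm (1 - fourier_char 1 x) * (1 / real (Suc m))"
    using \<open>1 \<le> n\<close> self_le_power [of "real (Suc m)" n]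
    by (intro mult_left_mono divide_left_mono) auto
  finally show ?thesis
    by (simp add: scaleR_conv_of_real divide_inverse mult.commute)
qed

lemma periodic_zeta_uniformly_convergent:
  assumes "1 \<le> n" "0 < \<delta>" and \<delta>: "\<And>x. x \<in> X \<Longrightarrow> \<delta> \<le> norm (1 - fourier_char 1 x)"
  shows "uniformly_convergent_on X (\<lambda>N x. \<Sum>k<N. fourier_char (int (Suc k)) x / of_nat (Suc k) ^ n)"
proof (rule uniformly_convergent_onI_blocks)
  fix e :: real assume "0 < e"
  obtain M :: nat where M: "2 / \<delta> / e < real M"
    using reals_Archimedean2 by blast
  show "\<exists>M. \<forall>m\<ge>M. \<forall>N\<ge>m. \<forall>x\<in>X. norm (\<Sum>k\<in>{m..<N}. fourier_char (int (Suc k)) x / of_nat (Suc k) ^ n) < e"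
  proof (intro exI [of _ M] allI impI ballI)
    fix m N x assume *: "M \<le> m" "m \<le> N" "x \<in> X"
    have "x \<notin> \<int>"
      using \<delta> [OF \<open>x \<in> X\<close>] \<open>0 < \<delta>\<close> by (auto simp: fourier_char_Ints)
    then have "norm (\<Sum>k\<in>{m..<N}. fourier_char (int (Suc k)) x / of_nat (Suc k) ^ n)
        \<le> 2 / norm (1 - fourier_char 1 x) * (1 / real (Suc m))"
      using assms * by (intro norm_periodic_zeta_block_le) auto
    also have "\<dots> \<le> 2 / \<delta> * (1 / real (Suc m))"
      using \<delta> [OF \<open>x \<in> X\<close>] \<open>0 < \<delta>\<close>
      by (intro mult_right_mono divide_left_mono) (auto intro!: mult_pos_pos)
    also have "\<dots> < e"
    proof -
      have "2 / \<delta> / e < real (Suc m)"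
        using M * by simp
      then have "2 / \<delta> < e * real (Suc m)"
        using \<open>0 < e\<close> by (simp only: pos_divide_less_eq mult.commute)
      then show ?thesis
        unfolding times_divide_eq_right mult_1_right
        by (simp only: pos_divide_less_eq of_nat_0_less_iff zero_less_Suc)
    qed
    finally show "norm (\<Sum>k\<in>{m..<N}. fourier_char (int (Suc k)) x / of_nat (Suc k) ^ n) < e" .
  qed
qed

lemma periodic_zeta_term_le:
  "2 \<le> n \<Longrightarrow> norm (fourier_char (int (Suc k)) x / of_nat (Suc k) ^ n) \<le> 1 / real (Suc k) ^ 2"
  using power_increasing [of 2 n "real (Suc k)"]
  by (auto simp: norm_divide norm_power simp del: of_nat_Suc intro!: divide_left_mono)

lemma periodic_zeta_sums:
  assumes "1 \<le> n" "2 \<le> n \<or> x \<notin> \<int>"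
  shows "(\<lambda>k. fourier_char (int (Suc k)) x / of_nat (Suc k) ^ n) sums periodic_zeta n x"
proof (cases "x \<in> \<int>")
  case False
  then have "0 < norm (1 - fourier_char 1 x)"
    by (auto simp: fourier_char_eq_1_iff [symmetric])
  then have "uniformly_convergent_on {x} (\<lambda>N x. \<Sum>k<N. fourier_char (int (Suc k)) x / of_nat (Suc k) ^ n)"
    using assms(1)
    by (intro periodic_zeta_uniformly_convergent [of n "norm (1 - fourier_char 1 x)"]) auto
  then have "convergent (\<lambda>N. \<Sum>k<N. fourier_char (int (Suc k)) x / of_nat (Suc k) ^ n)"
    by (rule uniformly_convergent_imp_convergent) simp
  then show ?thesis
    unfolding periodic_zeta_def by (simp only: summable_iff_convergent [symmetric] summable_sums)
next
  case True
  with assms have "2 \<le> n" by simp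
  then show ?thesis
    unfolding periodic_zeta_def
    by (intro summable_sums summable_comparison_test' [OF summable_inverse_squares_Suc [of 1]] periodic_zeta_term_le)
qed

lemma continuous_on_periodic_zeta:
  assumes "2 \<le> n"
  shows "continuous_on A (periodic_zeta n)"
proof -
  have "uniform_limit A (\<lambda>N x. \<Sum>k<N. fourier_char (int (Suc k)) x / of_nat (Suc k) ^ n)
      (periodic_zeta n) sequentially"
    unfolding periodic_zeta_def [abs_def]
    by (intro Weierstrass_m_test [OF _ summable_inverse_squares_Suc [of 1]] periodic_zeta_term_le assms)
  then show ?thesis
    by (rule uniform_limit_theorem [rotated])
      (auto intro!: always_eventually continuous_intros simp del: of_nat_Suc)
qed

lemma Re_fourier_char_has_derivative:
  "((\<lambda>x. Re (u * fourier_char k x)) has_real_derivative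
      2 * pi * of_int k * Re (\<i> * u * fourier_char k x)) (at x within S)"
  unfolding fourier_char_def
  by (auto intro!: derivative_eq_intros simp: algebra_simps)

lemma periodic_zeta_has_derivative:
  assumes "1 \<le> n" "0 < x" "x < 1"
  shows "((\<lambda>x. Re (u * periodic_zeta (Suc n) x)) has_real_derivative
      2 * pi * Re (\<i> * u * periodic_zeta n x)) (at x)"
proof -
  \<comment> \<open>A compact neighbourhood of \<open>x\<close> without integers.\<close>
  define S where "S = {x / 2..(1 + x) / 2}"
  have S: "convex S" "x \<in> interior S" "x \<in> S" "compact S" "S \<noteq> {}"
    using assms by (auto simp: S_def)
  have nonint: "y \<notin> \<int>" if "y \<in> S" for y
    using that assms by (intro nonint_unit_interval) (auto simp: S_def)
  have "continuous_on S (\<lambda>y. norm (1 - fourier_char 1 y))"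
    by (intro continuous_intros)
  then obtain y0 where "y0 \<in> S" and y0: "\<And>y. y \<in> S \<Longrightarrow> norm (1 - fourier_char 1 y0) \<le> norm (1 - fourier_char 1 y)"
    using continuous_attains_inf [OF \<open>compact S\<close> \<open>S \<noteq> {}\<close>] by blast
  have "0 < norm (1 - fourier_char 1 y0)"
    using nonint [OF \<open>y0 \<in> S\<close>] by (auto simp: fourier_char_eq_1_iff [symmetric])
  then have "uniformly_convergent_on S (\<lambda>N x. \<Sum>k<N. fourier_char (int (Suc k)) x / of_nat (Suc k) ^ n)"
    using assms y0 by (intro periodic_zeta_uniformly_convergent)
  then obtain l where l: "uniform_limit S (\<lambda>N x. \<Sum>k<N. fourier_char (int (Suc k)) x / of_nat (Suc k) ^ n) l sequentially"
    by (auto simp: uniformly_convergent_on_def)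
  define f where "f k x = Re (u * (fourier_char (int (Suc k)) x / of_nat (Suc k) ^ Suc n))" for k x
  define f' where "f' k x = 2 * pi * Re (\<i> * u * (fourier_char (int (Suc k)) x / of_nat (Suc k) ^ n))" for k x
  have "bounded_linear (\<lambda>z. 2 * pi * Re (\<i> * u * z))"
    by (intro bounded_linear_const_mult bounded_linear_compose [OF bounded_linear_Re] bounded_linear_mult_right)
  from bounded_linear.uniform_limit [OF this l]
  have "uniform_limit S (\<lambda>N x. \<Sum>k<N. f' k x) (\<lambda>x. 2 * pi * Re (\<i> * u * l x)) sequentially"
    by (simp only: f'_def sum_distrib_left Re_sum)
  then have unif: "uniformly_convergent_on S (\<lambda>N x. \<Sum>k<N. f' k x)"
    unfolding uniformly_convergent_on_def by blast
  have deriv: "(f k has_field_derivative f' k y) (at y within S)" for k y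
  proof -
    have *: "Re (v * (z / of_nat (Suc k) ^ m)) = Re (v * z) / real (Suc k) ^ m" for v z m
    proof -
      have "v * (z / of_nat (Suc k) ^ m) = (v * z) / of_real (real (Suc k) ^ m)"
        by (simp del: of_nat_Suc)
      then show ?thesis by (simp only: Re_divide_of_real)
    qed
    show ?thesis
      unfolding f_def f'_def *
      by (rule DERIV_cong [OF DERIV_cdivide [OF Re_fourier_char_has_derivative]]) (simp del: of_nat_Suc)
  qed
  have sums: "(\<lambda>k. f k y) sums Re (u * periodic_zeta (Suc n) y)"
    "(\<lambda>k. f' k y) sums (2 * pi * Re (\<i> * u * periodic_zeta n y))" if "y \<in> S" for y
  proof -
    have "(\<lambda>k. fourier_char (int (Suc k)) y / of_nat (Suc k) ^ m) sums periodic_zeta m y" if "1 \<le> m" for m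
      using nonint [OF \<open>y \<in> S\<close>] that by (intro periodic_zeta_sums) auto
    from this [of "Suc n"] this [of n] assms(1)
    show "(\<lambda>k. f k y) sums Re (u * periodic_zeta (Suc n) y)"
      "(\<lambda>k. f' k y) sums (2 * pi * Re (\<i> * u * periodic_zeta n y))"
      unfolding f_def f'_def
      by (simp_all only: sums_mult sums_Re Suc_eq_plus1 le_add2)
  qed
  have "((\<lambda>x. \<Sum>k. f k x) has_field_derivative (\<Sum>k. f' k x)) (at x)"
    by (rule has_field_derivative_series' [OF S(1) deriv unif S(3) sums_summable [OF sums(1) [OF S(3)]] S(2)])
  then have "((\<lambda>x. \<Sum>k. f k x) has_field_derivative (2 * pi * Re (\<i> * u * periodic_zeta n x))) (at x)"
    using sums(2) [OF \<open>x \<in> S\<close>] by (simp add: sums_iff)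
  then show ?thesis
    by (rule has_field_derivative_transform_within_open [of _ _ _ "interior S"])
      (use S sums(1) interior_subset [of S] in \<open>auto simp: sums_iff\<close>)
qed

text \<open>
  The logarithm series on the boundary of the unit disc: convergence there is known, so Abel's
  theorem identifies the sum with the radial limit.
\<close>

lemma periodic_zeta_1:
  assumes "x \<notin> \<int>"
  shows "periodic_zeta 1 x = - Ln (1 - fourier_char 1 x)"
proof -
  define z where "z = fourier_char 1 x"
  have "z \<noteq> 1"
    using assms by (simp add: z_def fourier_char_eq_1_iff)
  have "Re z < 1"
  proof -
    have "Re z \<le> 1" using complex_Re_le_cmod [of z] by (simp add: z_def)
    moreover have "Re z \<noteq> 1"
    proof
      assume "Re z = 1"
      moreover have "(Re z)\<^sup>2 + (Im z)\<^sup>2 = 1"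
        using cmod_power2 [of z] by (simp add: z_def)
      ultimately show False using \<open>z \<noteq> 1\<close> by (simp add: complex_eq_iff)
    qed
    ultimately show ?thesis by simp
  qed
  define r where "r j = 1 - 1 / real (Suc (Suc j))" for j
  have r: "0 \<le> r j" "r j < 1" for j
    by (auto simp: r_def)
  have r_lim: "r \<longlonglongrightarrow> 1"
    unfolding r_def by real_asymp
  have "(\<lambda>j. \<Sum>k. (r j ^ Suc k) *\<^sub>R (fourier_char (int (Suc k)) x / of_nat (Suc k) ^ 1)) \<longlonglongrightarrow> periodic_zeta 1 x"
  proof (rule abel_limit)
    show "(\<lambda>k. fourier_char (int (Suc k)) x / of_nat (Suc k) ^ 1) sums periodic_zeta 1 x"
      using assms by (intro periodic_zeta_sums) auto
    show "(\<lambda>j. r j ^ Suc k) \<longlonglongrightarrow> 1" for k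
      using tendsto_power [OF r_lim, of "Suc k"] by simp
    show "r j ^ Suc (Suc k) \<le> r j ^ Suc k" for j k
      using r [of j] by (intro power_decreasing) auto
  qed (use r in \<open>auto simp: less_imp_le\<close>)
  moreover have "(\<Sum>k. (r j ^ Suc k) *\<^sub>R (fourier_char (int (Suc k)) x / of_nat (Suc k) ^ 1)) = - Ln (1 - r j * z)" for j
  proof -
    have "cmod (- (r j * z)) < 1"
      using r [of j] by (simp add: norm_mult z_def)
    from Ln_series' [OF this] have "(\<lambda>n. - ((r j * z) ^ n) / of_nat n) sums Ln (1 - r j * z)"
      by simp
    then have "(\<lambda>n. - ((r j * z) ^ Suc n) / of_nat (Suc n)) sums Ln (1 - r j * z)"
      by (subst sums_Suc_iff) simp
    from sums_minus [OF this] show ?thesis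
      by (simp add: sums_iff fourier_char_power scaleR_conv_of_real power_mult_distrib z_def
          del: of_nat_Suc power_Suc)
  qed
  moreover have "(\<lambda>j. - Ln (1 - r j * z)) \<longlonglongrightarrow> - Ln (1 - of_real 1 * z)"
    using \<open>Re z < 1\<close> by (intro tendsto_intros r_lim) (auto simp: complex_nonpos_Reals_iff)
  ultimately have "periodic_zeta 1 x = - Ln (1 - of_real 1 * z)"
    by (simp only: LIMSEQ_unique)
  then show ?thesis by (simp add: z_def)
qed

text \<open>
  The sawtooth wave: \<open>1 - cis (2 * pi * x)\<close> has modulus \<open>2 * sin (pi * x)\<close> and argument
  \<open>pi * x - pi / 2\<close>.
\<close>

lemma Im_periodic_zeta_1:
  assumes "0 < x" "x < 1"
  shows "Im (periodic_zeta 1 x) = pi * (1 / 2 - x)"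
proof -
  have sin: "0 < sin (pi * x)"
    using assms by (intro sin_gt_zero) auto
  have pix: "0 < pi * x" "pi * x < pi"
    using assms by auto
  have "x \<notin> \<int>"
    using assms by (rule nonint_unit_interval)
  have "exp (Complex (ln (2 * sin (pi * x))) (pi * x - pi / 2)) = 1 - fourier_char 1 x"
    using sin cos_double_sin [of "pi * x"] sin_double [of "pi * x"]
    by (simp add: complex_eq_iff fourier_char_def Re_exp Im_exp cos_diff sin_diff power2_eq_square mult_ac)
  then have "Ln (1 - fourier_char 1 x) = Complex (ln (2 * sin (pi * x))) (pi * x - pi / 2)"
    
  proof (intro Ln_unique)
    show "- pi < Im (Complex (ln (2 * sin (pi * x))) (pi * x - pi / 2))"
      "Im (Complex (ln (2 * sin (pi * x))) (pi * x - pi / 2)) \<le> pi"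
      using pix pi_gt_zero unfolding complex.sel by linarith+
  qed
  then show ?thesis
    using periodic_zeta_1 [OF \<open>x \<notin> \<int>\<close>] by (simp add: algebra_simps)
qed

section \<open>The functional equation in terms of Fourier coefficients\<close>

text \<open>
  Orthogonality of the characters of the cyclic group of order \<open>a\<close>.
\<close>

lemma sum_fourier_char_translates:
  assumes "1 \<le> a"
  shows "(\<Sum>j<a. fourier_char k (x + real j / real a)) = (if int a dvd k then of_nat a * fourier_char k x else 0)"
proof -
  define \<omega> where "\<omega> = fourier_char k (1 / real a)"
  have pow: "fourier_char k (real j / real a) = \<omega> ^ j" for j
    unfolding \<omega>_def fourier_char_def by (simp add: Complex.DeMoivre mult_ac)
  have eq: "(\<Sum>j<a. fourier_char k (x + real j / real a)) = fourier_char k x * (\<Sum>j<a. \<omega> ^ j)"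
    by (simp only: fourier_char_add pow sum_distrib_left)
  have "\<omega> ^ a = 1"
    using pow [of a] assms fourier_char_of_int [of k 1] by simp
  have "\<omega> = fourier_char 1 (of_int k / real a)"
    by (simp add: \<omega>_def fourier_char_def)
  then have "\<omega> = 1 \<longleftrightarrow> of_int k / real a \<in> \<int>"
    by (simp add: fourier_char_eq_1_iff)
  also have "\<dots> \<longleftrightarrow> int a dvd k"
    using of_int_div_of_int_in_Ints_iff [of k "int a", where 'a = real] assms by simp
  finally have "\<omega> = 1 \<longleftrightarrow> int a dvd k" .
  moreover have "(\<Sum>j<a. \<omega> ^ j) = (if \<omega> = 1 then of_nat a else 0)"
    using geometric_sum [of \<omega> a] \<open>\<omega> ^ a = 1\<close> by (cases "\<omega> = 1") simp_all
  ultimately show ?thesis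
    unfolding eq by simp
qed

text \<open>
  Averaging over the translates by \<open>j / a\<close> keeps only the frequencies divisible by \<open>a\<close>. The cutoff
  \<open>a * N\<close> is chosen so that exactly the multiples of \<open>a\<close> with quotient in \<open>{- N..N}\<close> survive.
\<close>

lemma sum_sym_sum_translates:
  assumes "1 \<le> a"
  shows "(\<Sum>j<a. sym_sum c (a * N) (x + real j / real a)) = of_nat a * sym_sum (\<lambda>k. c (int a * k)) N (real a * x)"
proof -
  let ?K = "{- int (a * N)..int (a * N)}"
  have "(\<Sum>j<a. sym_sum c (a * N) (x + real j / real a))
      = (\<Sum>k\<in>?K. c k * (\<Sum>j<a. fourier_char k (x + real j / real a)))"
    unfolding sym_sum_def by (subst sum.swap) (simp add: sum_distrib_left)
  also have "\<dots> = (\<Sum>k\<in>?K. if int a dvd k then c k * (of_nat a * fourier_char k x) else 0)"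
    unfolding sum_fourier_char_translates [OF assms] by (intro sum.cong) auto
  also have "\<dots> = (\<Sum>k\<in>{k \<in> ?K. int a dvd k}. c k * (of_nat a * fourier_char k x))"
    by (rule sum.inter_filter [symmetric]) simp
  also have "\<dots> = (\<Sum>k\<in>{- int N..int N}. c (int a * k) * (of_nat a * fourier_char (int a * k) x))"
  proof (rule sum.reindex_bij_betw [symmetric])
    have "0 < int a" using assms by simp
    then show "bij_betw ((*) (int a)) {- int N..int N} {k \<in> ?K. int a dvd k}"
      unfolding bij_betw_def inj_on_def
      by (auto simp: dvd_def mult_le_cancel_left_pos minus_mult_right simp del: mult_minus_right)
  qed
  finally show ?thesis
    unfolding sym_sum_def fourier_char_mult by (simp add: sum_distrib_left mult_ac)
qed

lemma translates_in_domain: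
  assumes "D = UNIV \<or> D = - \<int>" "1 \<le> a" "real a * x \<in> D"
  shows "x + real j / real a \<in> D"
proof -
  have "real a * x \<in> \<int>" if "x + real j / real a \<in> \<int>"
  proof -
    have "real a * (x + real j / real a) - real j \<in> \<int>"
      using that by (intro Ints_diff Ints_mult) auto
    then show ?thesis using assms(2) by (simp add: distrib_left)
  qed
  then show ?thesis using assms by auto
qed

lemma sym_sum_translates_tendsto:
  assumes D: "D = UNIV \<or> D = - \<int>" and "1 \<le> a" "real a * x \<in> D"
    and lim: "\<And>x. x \<in> D \<Longrightarrow> (\<lambda>N. sym_sum c N x) \<longlonglongrightarrow> complex_of_real (f x)"
  shows "(\<lambda>N. of_nat a * sym_sum (\<lambda>k. c (int a * k)) N (real a * x))
            \<longlonglongrightarrow> complex_of_real (\<Sum>j<a. f (x + real j / real a))"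
proof -
  have "strict_mono (\<lambda>N. a * N)"
    using \<open>1 \<le> a\<close> by (simp add: strict_mono_def)
  then have "(\<lambda>N. sym_sum c (a * N) (x + real j / real a)) \<longlonglongrightarrow> complex_of_real (f (x + real j / real a))" for j
    using LIMSEQ_subseq_LIMSEQ [OF lim [OF translates_in_domain [OF assms(1-3)]]] by (simp add: o_def)
  then have "(\<lambda>N. \<Sum>j<a. sym_sum c (a * N) (x + real j / real a))
      \<longlonglongrightarrow> (\<Sum>j<a. complex_of_real (f (x + real j / real a)))"
    by (intro tendsto_sum)
  then show ?thesis
    by (simp add: sum_sym_sum_translates [OF \<open>1 \<le> a\<close>])
qed

lemma functional_eq_of_coeffs:
  assumes D: "D = UNIV \<or> D = - \<int>" and "1 \<le> a" "1 \<le> n"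
    and lim: "\<And>x. x \<in> D \<Longrightarrow> (\<lambda>N. sym_sum c N x) \<longlonglongrightarrow> complex_of_real (f x)"
    and c: "\<And>k. of_nat a ^ n * c (int a * k) = c k"
  shows "functional_eq_on D n a f"
  unfolding functional_eq_on_def
proof (intro allI impI)
  fix x assume x: "real a * x \<in> D"
  have pow: "of_nat a ^ (n - 1) * (of_nat a * z) = of_nat a ^ n * z" for z :: complex
    using \<open>1 \<le> n\<close> by (cases n) auto
  have "(\<lambda>N. of_nat a ^ (n - 1) * (of_nat a * sym_sum (\<lambda>k. c (int a * k)) N (real a * x)))
      \<longlonglongrightarrow> of_nat a ^ (n - 1) * complex_of_real (\<Sum>j<a. f (x + real j / real a))"
    by (intro tendsto_mult_left sym_sum_translates_tendsto [OF D \<open>1 \<le> a\<close> x lim])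
  then have "(\<lambda>N. sym_sum c N (real a * x))
      \<longlonglongrightarrow> of_nat a ^ (n - 1) * complex_of_real (\<Sum>j<a. f (x + real j / real a))"
    by (simp only: pow sym_sum_cmult [symmetric] c)
  from LIMSEQ_unique [OF this lim [OF x]]
  have "complex_of_real (f (real a * x)) = of_real (real a ^ (n - 1) * (\<Sum>j<a. f (x + real j / real a)))"
    by simp
  then show "f (real a * x) = real a ^ (n - 1) * (\<Sum>k<a. f (x + real k / real a))"
    by (simp only: of_real_eq_iff)
qed

text \<open>
  Both sides of the functional equation are trigonometric series in \<open>a * x\<close>; they agree off the
  integers, hence coefficientwise.
\<close>

lemma coeffs_of_functional_eq:
  assumes D: "D = UNIV \<or> D = - \<int>" and "1 \<le> a" "1 \<le> n"
    and lim: "\<And>x. x \<in> D \<Longrightarrow> (\<lambda>N. sym_sum c N x) \<longlonglongrightarrow> complex_of_real (f x)"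
    and eq: "functional_eq_on D n a f"
  shows "of_nat a ^ n * c (int a * k) = c k"
proof -
  have pow: "of_nat a ^ (n - 1) * (of_nat a * z) = of_nat a ^ n * z" for z :: complex
    using \<open>1 \<le> n\<close> by (cases n) auto
  have "(\<lambda>N. sym_sum (\<lambda>k. of_nat a ^ n * c (int a * k) - c k) N y) \<longlonglongrightarrow> 0" if "y \<notin> \<int>" for y
  proof -
    define x where "x = y / real a"
    have y: "real a * x = y"
      using \<open>1 \<le> a\<close> by (simp add: x_def)
    then have x: "real a * x \<in> D"
      using D that by auto
    have "(\<lambda>N. of_nat a ^ (n - 1) * (of_nat a * sym_sum (\<lambda>k. c (int a * k)) N (real a * x)) - sym_sum c N (real a * x))
        \<longlonglongrightarrow> of_nat a ^ (n - 1) * complex_of_real (\<Sum>j<a. f (x + real j / real a)) - complex_of_real (f (real a * x))"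
      by (intro tendsto_diff tendsto_mult_left sym_sum_translates_tendsto [OF D \<open>1 \<le> a\<close> x lim] lim x)
    moreover have "f (real a * x) = real a ^ (n - 1) * (\<Sum>j<a. f (x + real j / real a))"
      using eq x by (simp add: functional_eq_on_def)
    ultimately show ?thesis
      unfolding sym_sum_diff sym_sum_cmult pow y by (simp only: of_real_mult of_real_power of_real_of_nat_eq diff_self)
  qed
  from trig_series_uniqueness [OF this, of k] show ?thesis by simp
qed

text \<open>
  The Fourier coefficients of \<open>Re (w * periodic_zeta n x)\<close>. The conjugate at negative frequencies makes
  the function real-valued.
\<close>

definition power_law_coeff :: "nat \<Rightarrow> complex \<Rightarrow> int \<Rightarrow> complex" where
  "power_law_coeff n w k =
     (if k = 0 then 0 else (if 0 < k then w else cnj w) / 2 / of_int \<bar>k\<bar> ^ n)"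

lemma power_law_coeff_mult:
  assumes "1 \<le> a"
  shows "of_nat a ^ n * power_law_coeff n w (int a * k) = power_law_coeff n w k"
  using assms by (auto simp: power_law_coeff_def abs_mult power_mult_distrib zero_less_mult_iff)

lemma sym_sum_power_law_coeff:
  "sym_sum (power_law_coeff n w) N x
     = of_real (\<Sum>k<N. Re (w * (fourier_char (int (Suc k)) x / of_nat (Suc k) ^ n)))"
proof -
  have "power_law_coeff n w (int (Suc k)) * fourier_char (int (Suc k)) x
        + power_law_coeff n w (- int (Suc k)) * fourier_char (- int (Suc k)) x
      = of_real (Re (w * (fourier_char (int (Suc k)) x / of_nat (Suc k) ^ n)))" for k
  proof -
    define t where "t = w * (fourier_char (int (Suc k)) x / of_nat (Suc k) ^ n)"
    have "power_law_coeff n w (int (Suc k)) * fourier_char (int (Suc k)) x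
        + power_law_coeff n w (- int (Suc k)) * fourier_char (- int (Suc k)) x = (t + cnj t) / 2"
      by (simp add: power_law_coeff_def t_def fourier_char_uminus add_divide_distrib mult_ac del: of_nat_Suc)
    also have "\<dots> = of_real (Re t)"
      by (simp add: complex_add_cnj)
    finally show ?thesis
      unfolding t_def .
  qed
  then show ?thesis
    by (simp add: sym_sum_eq_sum power_law_coeff_def del: of_nat_Suc)
qed

lemma sym_sum_power_law_coeff_tendsto_iff:
  "(\<lambda>N. sym_sum (power_law_coeff n w) N x) \<longlonglongrightarrow> complex_of_real y \<longleftrightarrow>
     (\<lambda>k. Re (w * (fourier_char (int (Suc k)) x / of_nat (Suc k) ^ n))) sums y"
  by (simp only: sym_sum_power_law_coeff sums_def tendsto_of_real_iff)

lemma Re_periodic_zeta_sums: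
  assumes "1 \<le> n" "2 \<le> n \<or> x \<notin> \<int>"
  shows "(\<lambda>k. Re (w * (fourier_char (int (Suc k)) x / of_nat (Suc k) ^ n))) sums Re (w * periodic_zeta n x)"
  by (intro sums_Re sums_mult periodic_zeta_sums assms)

lemma periodic_zeta_functional_eq:
  assumes "1 \<le> n" "1 \<le> a"
  shows "functional_eq_on (- \<int>) n a (\<lambda>x. Re (w * periodic_zeta n x))"
proof (rule functional_eq_of_coeffs)
  show "(\<lambda>N. sym_sum (power_law_coeff n w) N x) \<longlonglongrightarrow> complex_of_real (Re (w * periodic_zeta n x))"
    if "x \<in> - \<int>" for x
    unfolding sym_sum_power_law_coeff_tendsto_iff using that assms by (intro Re_periodic_zeta_sums) auto
qed (use assms in \<open>auto simp: power_law_coeff_mult\<close>)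

text \<open>
  For \<open>a = Suc k \<ge> 2\<close> the relation at \<open>1\<close> and \<open>- 1\<close> determines all coefficients except the zeroth,
  which must vanish because it is fixed by multiplication with \<open>2 ^ n \<noteq> 1\<close>.
\<close>

lemma power_law_of_multiplicative:
  fixes c :: "int \<Rightarrow> complex"
  assumes mult: "\<And>a k. 2 \<le> a \<Longrightarrow> of_nat a ^ n * c (int a * k) = c k" and "1 \<le> n"
  shows "c 0 = 0" "c (int (Suc k)) = c 1 / of_nat (Suc k) ^ n" "c (- int (Suc k)) = c (- 1) / of_nat (Suc k) ^ n"
proof -
  have "c 0 = 2 ^ n * c 0"
    using mult [of 2 0] by simp
  moreover have "(2 :: complex) ^ n \<noteq> 1"
  proof
    assume "(2 :: complex) ^ n = 1"
    then have "norm ((2 :: complex) ^ n) = 1" by simp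
    then show False using \<open>1 \<le> n\<close> one_less_power [of "2 :: real" n] by (simp add: norm_power)
  qed
  ultimately show "c 0 = 0" by simp
  have "of_nat (Suc k) ^ n * c (int (Suc k) * l) = c l" for l
    using mult [of "Suc k" l] by (cases k) auto
  from this [of 1] this [of "- 1"]
  show "c (int (Suc k)) = c 1 / of_nat (Suc k) ^ n" "c (- int (Suc k)) = c (- 1) / of_nat (Suc k) ^ n"
    by (auto simp: field_simps simp del: of_nat_Suc)
qed

text \<open>
  The two real parameters are combined into \<open>w = Complex \<alpha> (- \<beta>)\<close>, and the separate convergence
  conditions into convergence of a single series. The two differ only for \<open>n = 1\<close> at an integer,
  where the sine terms are \<open>0\<close> and the cosine terms form the harmonic series: convergence of the
  combined series forces the coefficient of the latter to be \<open>0\<close>.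
\<close>

lemma trig_form_iff:
  assumes "1 \<le> n"
  shows "trig_form_on D n f \<longleftrightarrow>
    (\<exists>w. \<forall>x\<in>D. (\<lambda>k. Re (w * (fourier_char (int (Suc k)) x / of_nat (Suc k) ^ n))) sums f x)"
    (is "_ \<longleftrightarrow> (\<exists>w. \<forall>x\<in>D. ?sums w x)")
proof -
  define t where "t x k = fourier_char (int (Suc k)) x / of_nat (Suc k) ^ n" for x k
  have Re_t: "cos (2 * pi * real (Suc k) * x) / real (Suc k) ^ n = Re (t x k)"
    and Im_t: "sin (2 * pi * real (Suc k) * x) / real (Suc k) ^ n = Im (t x k)" for x k
  proof -
    have "t x k = fourier_char (int (Suc k)) x / of_real (real (Suc k) ^ n)"
      by (simp add: t_def)
    then show "cos (2 * pi * real (Suc k) * x) / real (Suc k) ^ n = Re (t x k)"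
      "sin (2 * pi * real (Suc k) * x) / real (Suc k) ^ n = Im (t x k)"
      by (simp_all only: Re_divide_of_real Im_divide_of_real) (simp_all add: fourier_char_def)
  qed
  have Re_w: "Re (w * t x k) = Re w * Re (t x k) + - Im w * Im (t x k)" for w x k
    by simp
  show ?thesis
    unfolding trig_form_on_def Re_t Im_t t_def [symmetric]
  proof
    assume "\<exists>\<alpha> \<beta>. \<forall>x\<in>D. (\<alpha> \<noteq> 0 \<longrightarrow> summable (\<lambda>k. Re (t x k))) \<and> (\<beta> \<noteq> 0 \<longrightarrow> summable (\<lambda>k. Im (t x k))) \<and>
        f x = \<alpha> * (\<Sum>k. Re (t x k)) + \<beta> * (\<Sum>k. Im (t x k))"
    then obtain \<alpha> \<beta> where *: "\<And>x. x \<in> D \<Longrightarrow> (\<alpha> \<noteq> 0 \<longrightarrow> summable (\<lambda>k. Re (t x k))) \<and>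
        (\<beta> \<noteq> 0 \<longrightarrow> summable (\<lambda>k. Im (t x k))) \<and>
        f x = \<alpha> * (\<Sum>k. Re (t x k)) + \<beta> * (\<Sum>k. Im (t x k))"
      by blast
    have mult: "(\<lambda>k. \<gamma> * g k) sums (\<gamma> * suminf g)" if "\<gamma> \<noteq> 0 \<longrightarrow> summable g" for \<gamma> :: real and g
      using that by (cases "\<gamma> = 0") (auto intro: sums_mult summable_sums)
    have "(\<lambda>k. Re (Complex \<alpha> (- \<beta>) * t x k)) sums f x" if "x \<in> D" for x
    proof -
      have "(\<lambda>k. \<alpha> * Re (t x k) + \<beta> * Im (t x k)) sums (\<alpha> * (\<Sum>k. Re (t x k)) + \<beta> * (\<Sum>k. Im (t x k)))"
        using * [OF that] by (intro sums_add mult) auto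
      then show ?thesis
        using * [OF that] by (simp add: Re_w)
    qed
    then show "\<exists>w. \<forall>x\<in>D. (\<lambda>k. Re (w * t x k)) sums f x"
      by blast
  next
    assume "\<exists>w. \<forall>x\<in>D. (\<lambda>k. Re (w * t x k)) sums f x"
    then obtain w where w: "\<And>x. x \<in> D \<Longrightarrow> (\<lambda>k. Re (w * t x k)) sums f x"
      by blast
    have "(Re w \<noteq> 0 \<longrightarrow> summable (\<lambda>k. Re (t x k))) \<and> (- Im w \<noteq> 0 \<longrightarrow> summable (\<lambda>k. Im (t x k))) \<and>
        f x = Re w * (\<Sum>k. Re (t x k)) + - Im w * (\<Sum>k. Im (t x k))" if "x \<in> D" for x
    proof (cases "2 \<le> n \<or> x \<notin> \<int>")
      case True
      then have "t x sums periodic_zeta n x"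
        unfolding t_def using \<open>1 \<le> n\<close> by (intro periodic_zeta_sums)
      from sums_Re [OF this] sums_Im [OF this]
      have sums: "(\<lambda>k. Re (t x k)) sums Re (periodic_zeta n x)" "(\<lambda>k. Im (t x k)) sums Im (periodic_zeta n x)" .
      from sums_add [OF sums_mult [OF sums(1)] sums_mult [OF sums(2)]]
      have "(\<lambda>k. Re (w * t x k)) sums (Re w * Re (periodic_zeta n x) + - Im w * Im (periodic_zeta n x))"
        unfolding Re_w .
      with w [OF that] sums show ?thesis
        by (auto simp: sums_iff)
    next
      case False
      with \<open>1 \<le> n\<close> have "n = 1" "x \<in> \<int>" by auto
      then have t: "t x k = of_real (1 / real (Suc k))" for k
        by (simp add: t_def fourier_char_Ints)
      have "Re w = 0"
      proof (rule ccontr)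
        assume "Re w \<noteq> 0"
        have "(\<lambda>k. Re w * inverse (real (Suc k))) sums f x"
          using w [OF that] unfolding Re_w unfolding t
          by (simp only: Re_complex_of_real Im_complex_of_real inverse_eq_divide mult_zero_right add_0_right)
        then have "summable (\<lambda>k. inverse (real (Suc k)))"
          using \<open>Re w \<noteq> 0\<close> by (auto dest!: sums_summable simp: summable_cmult_iff)
        then show False
          using not_summable_harmonic [where 'a = real] by (subst (asm) summable_Suc_iff) simp
      qed
      then show ?thesis
        using w [OF that] unfolding Re_w unfolding t by (simp add: sums_iff del: of_nat_Suc)
    qed
    then show "\<exists>\<alpha> \<beta>. \<forall>x\<in>D. (\<alpha> \<noteq> 0 \<longrightarrow> summable (\<lambda>k. Re (t x k))) \<and> (\<beta> \<noteq> 0 \<longrightarrow> summable (\<lambda>k. Im (t x k))) \<and>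
        f x = \<alpha> * (\<Sum>k. Re (t x k)) + \<beta> * (\<Sum>k. Im (t x k))"
      by blast
  qed
qed

section \<open>Fourier expansion of the Bernoulli polynomials\<close>

definition bernoulli_fps :: "real \<Rightarrow> real fps" where
  "bernoulli_fps x = Abs_fps (\<lambda>n. bernoulli_poly n x / fact n)"

lemma bernoulli_fps_mult: "bernoulli_fps x * (fps_exp 1 - 1) = fps_X * fps_exp x"
  unfolding bernoulli_fps_def by (rule bernoulli_poly_generating_function)

lemma fps_exp_minus_1_nonzero: "fps_exp (1 :: real) - 1 \<noteq> 0"
  by (auto simp: fps_eq_iff intro!: exI [of _ 1])

lemma bernoulli_fps_eq: "bernoulli_fps x = bernoulli_fps 0 * fps_exp x"
proof -
  have "bernoulli_fps x * (fps_exp 1 - 1) = (bernoulli_fps 0 * fps_exp x) * (fps_exp 1 - 1)"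
    using bernoulli_fps_mult [of x] bernoulli_fps_mult [of 0] by (simp add: mult_ac)
  then show ?thesis
    using fps_exp_minus_1_nonzero by simp
qed

lemma bernoulli_poly_eq_sum:
  "bernoulli_poly n x = fact n * (\<Sum>i=0..n. fps_nth (bernoulli_fps 0) i * (x ^ (n - i) / fact (n - i)))"
proof -
  have "fps_nth (bernoulli_fps x) n = (\<Sum>i=0..n. fps_nth (bernoulli_fps 0) i * (x ^ (n - i) / fact (n - i)))"
    by (subst bernoulli_fps_eq) (simp add: fps_mult_nth)
  then show ?thesis by (simp add: bernoulli_fps_def field_simps)
qed

lemma bernoulli_poly_has_derivative:
  "(bernoulli_poly (Suc n) has_real_derivative real (Suc n) * bernoulli_poly n x) (at x)"
proof -
  have monomial: "((\<lambda>x. x ^ Suc m / fact (Suc m)) has_real_derivative x ^ m / fact m) (at x)" for m and x :: real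
    by (rule DERIV_cong [OF DERIV_cdivide [OF DERIV_pow]]) (simp del: of_nat_Suc)
  let ?c = "fps_nth (bernoulli_fps 0)"
  have split: "(\<Sum>i=0..Suc n. ?c i * (y ^ (Suc n - i) / fact (Suc n - i)))
      = (\<Sum>i=0..n. ?c i * (y ^ Suc (n - i) / fact (Suc (n - i)))) + ?c (Suc n)" for y
    by (simp add: Suc_diff_le del: power_Suc fact_Suc)
  have "((\<lambda>y. fact (Suc n) * ((\<Sum>i=0..n. ?c i * (y ^ Suc (n - i) / fact (Suc (n - i)))) + ?c (Suc n)))
      has_real_derivative fact (Suc n) * ((\<Sum>i=0..n. ?c i * (x ^ (n - i) / fact (n - i))) + 0)) (at x)"
    by (intro DERIV_cmult DERIV_add DERIV_sum DERIV_const monomial)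
  moreover have "fact (Suc n) * (s + 0) = real (Suc n) * (fact n * s)" for s :: real
    by (simp add: algebra_simps)
  ultimately show ?thesis
    unfolding bernoulli_poly_eq_sum [abs_def] split by (simp only:)
qed

lemma bernoulli_poly_1: "bernoulli_poly 1 x = x - 1 / 2"
proof -
  have "fps_nth (bernoulli_fps x * (fps_exp 1 - 1)) 1 = fps_nth (fps_X * fps_exp x) 1"
    "fps_nth (bernoulli_fps x * (fps_exp 1 - 1)) 2 = fps_nth (fps_X * fps_exp x) 2"
    by (simp_all only: bernoulli_fps_mult)
  then show ?thesis
    by (simp add: fps_mult_nth bernoulli_fps_def numeral_2_eq_2)
qed

text \<open>
  The case \<open>a = 2\<close> of the multiplication theorem. Substituting \<open>t / 2\<close> for \<open>t\<close> in the generating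
  function and expanding the fraction by \<open>exp (t / 2) + 1\<close> turns the denominator
  \<open>exp (t / 2) - 1\<close> back into \<open>exp t - 1\<close>.
\<close>

lemma bernoulli_poly_duplication:
  assumes "1 \<le> n"
  shows "bernoulli_poly n (2 * x) = 2 ^ (n - 1) * (bernoulli_poly n x + bernoulli_poly n (x + 1 / 2))"
proof -
  let ?h = "fps_const (1 / 2) * fps_X :: real fps"
  have h0: "fps_nth ?h 0 = 0" by simp
  have exp_h: "fps_compose (fps_exp c) ?h = fps_exp (c / 2)" for c :: real
    by (simp add: fps_compose_linear fps_eq_iff power_divide)
  have "fps_compose (bernoulli_fps (2 * x) * (fps_exp 1 - 1)) ?h = fps_compose (fps_X * fps_exp (2 * x)) ?h"
    by (simp only: bernoulli_fps_mult)
  then have scaled: "fps_compose (bernoulli_fps (2 * x)) ?h * (fps_exp (1 / 2) - 1) = ?h * fps_exp x"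
    by (simp add: fps_compose_mult_distrib [OF h0] fps_compose_sub_distrib exp_h fps_compose_1
        del: fps_compose_linear)
  have half: "fps_exp (1 / 2) * fps_exp (1 / 2) = fps_exp (1 :: real)"
    "fps_exp x * fps_exp (1 / 2) = fps_exp (x + 1 / 2)"
    by (simp_all add: fps_exp_add_mult [symmetric])
  have "fps_compose (bernoulli_fps (2 * x)) ?h * (fps_exp 1 - 1)
      = (fps_compose (bernoulli_fps (2 * x)) ?h * (fps_exp (1 / 2) - 1)) * (fps_exp (1 / 2) + 1)"
    unfolding half(1) [symmetric] by (simp add: algebra_simps)
  also have "\<dots> = fps_const (1 / 2) * (fps_X * fps_exp x + fps_X * fps_exp (x + 1 / 2))"
    unfolding scaled half(2) [symmetric] by (simp add: algebra_simps)
  also have "\<dots> = (fps_const (1 / 2) * (bernoulli_fps x + bernoulli_fps (x + 1 / 2))) * (fps_exp 1 - 1)"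
    unfolding bernoulli_fps_mult [symmetric] by (simp add: algebra_simps)
  finally have "fps_compose (bernoulli_fps (2 * x)) ?h = fps_const (1 / 2) * (bernoulli_fps x + bernoulli_fps (x + 1 / 2))"
    using fps_exp_minus_1_nonzero by simp
  then have "fps_nth (fps_compose (bernoulli_fps (2 * x)) ?h) n
      = fps_nth (fps_const (1 / 2) * (bernoulli_fps x + bernoulli_fps (x + 1 / 2))) n"
    by simp
  moreover have "fps_nth (fps_compose (bernoulli_fps (2 * x)) ?h) n = (1 / 2) ^ n * bernoulli_poly n (2 * x) / fact n"
    by (simp add: fps_compose_linear bernoulli_fps_def)
  moreover have "fps_nth (fps_const (1 / 2) * (bernoulli_fps x + bernoulli_fps (x + 1 / 2))) n
      = 1 / 2 * (bernoulli_poly n x + bernoulli_poly n (x + 1 / 2)) / fact n"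
    by (simp add: bernoulli_fps_def add_divide_distrib)
  ultimately have "(1 / 2) ^ n * bernoulli_poly n (2 * x) / fact n
      = 1 / 2 * (bernoulli_poly n x + bernoulli_poly n (x + 1 / 2)) / fact n"
    by (simp only:)
  then have "(1 / 2) ^ n * bernoulli_poly n (2 * x) = 1 / 2 * (bernoulli_poly n x + bernoulli_poly n (x + 1 / 2))"
    by (simp only: divide_cancel_right fact_nonzero if_False simp_thms)
  moreover have "(2 :: real) ^ n = 2 * 2 ^ (n - 1)"
    using assms by (cases n) auto
  ultimately show ?thesis
    by (simp add: power_divide field_simps)
qed

definition bernoulli_factor :: "nat \<Rightarrow> real" where
  "bernoulli_factor n = - 2 * fact n / (2 * pi) ^ n"

definition phase :: "nat \<Rightarrow> complex" where
  "phase n = cis (- (real n * pi / 2))"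

lemma phase_Suc: "\<i> * phase (Suc n) = phase n"
proof -
  have "- (real (Suc n) * pi / 2) = - (real n * pi / 2) + - (pi / 2)"
    by (simp add: field_simps)
  then have "phase (Suc n) = cis (- (real n * pi / 2) + - (pi / 2))"
    by (simp only: phase_def)
  also have "\<dots> = phase n * cis (- (pi / 2))"
    by (simp only: phase_def cis_mult)
  finally show ?thesis
    by (simp add: complex_eq_iff)
qed

lemma bernoulli_factor_Suc: "2 * pi * bernoulli_factor (Suc n) = real (Suc n) * bernoulli_factor n"
  by (simp add: bernoulli_factor_def field_simps)

lemma bernoulli_factor_nonzero: "bernoulli_factor n \<noteq> 0"
  by (simp add: bernoulli_factor_def)

text \<open>
  Induction on \<open>n\<close>, starting from the sawtooth wave. By the induction hypothesis both sides have the
  same derivative, so they differ by a constant \<open>K\<close> on the unit interval. Both sides satisfy the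
  functional equation for \<open>a = 2\<close>, evaluated here at \<open>1 / 4\<close>, so that \<open>K = 2 ^ Suc n * K\<close>, which
  leaves only \<open>K = 0\<close>.
\<close>

lemma bernoulli_poly_eq_periodic_zeta_open:
  assumes "1 \<le> n" "0 < x" "x < 1"
  shows "bernoulli_poly n x = bernoulli_factor n * Re (phase n * periodic_zeta n x)"
  using assms
proof (induction n arbitrary: x rule: nat_induct_at_least)
  case base
  have "Re (phase 1 * periodic_zeta 1 x) = Im (periodic_zeta 1 x)"
    by (simp add: phase_def)
  then show ?case
    unfolding \<open>Re (phase 1 * periodic_zeta 1 x) = _\<close> Im_periodic_zeta_1 [OF base] bernoulli_poly_1
    by (simp add: bernoulli_factor_def field_simps)
next
  case (Suc n)
  define g where "g y = bernoulli_factor (Suc n) * Re (phase (Suc n) * periodic_zeta (Suc n) y)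
      - bernoulli_poly (Suc n) y" for y
  have "(g has_real_derivative 0) (at y)" if "y \<in> {0<..<1}" for y
  proof -
    have "(g has_real_derivative bernoulli_factor (Suc n) * (2 * pi * Re (\<i> * phase (Suc n) * periodic_zeta n y))
        - real (Suc n) * bernoulli_poly n y) (at y)"
      unfolding g_def using that Suc.hyps
      by (intro DERIV_diff DERIV_cmult periodic_zeta_has_derivative bernoulli_poly_has_derivative) auto
    moreover have "bernoulli_factor (Suc n) * (2 * pi * Re (\<i> * phase (Suc n) * periodic_zeta n y))
        = real (Suc n) * (bernoulli_factor n * Re (phase n * periodic_zeta n y))"
      unfolding phase_Suc using bernoulli_factor_Suc [of n] by (metis mult.assoc mult.commute)
    ultimately show ?thesis
      using Suc.IH [of y] that by simp
  qed
  then obtain K where K: "\<And>y. y \<in> {0<..<1} \<Longrightarrow> g y = K"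
    using has_field_derivative_zero_constant [OF convex_real_interval(8) has_field_derivative_at_within]
    by blast
  have "functional_eq_on (- \<int>) (Suc n) 2 (\<lambda>x. Re (phase (Suc n) * periodic_zeta (Suc n) x))"
    by (rule periodic_zeta_functional_eq) auto
  moreover have "real 2 * (1 / 4) \<in> - \<int>"
    by simp
  ultimately have "Re (phase (Suc n) * periodic_zeta (Suc n) (real 2 * (1 / 4)))
      = real 2 ^ (Suc n - 1) * (\<Sum>j<2. Re (phase (Suc n) * periodic_zeta (Suc n) (1 / 4 + real j / real 2)))"
    unfolding functional_eq_on_def by blast
  then have "Re (phase (Suc n) * periodic_zeta (Suc n) (1 / 2)) =
      2 ^ n * (Re (phase (Suc n) * periodic_zeta (Suc n) (1 / 4)) + Re (phase (Suc n) * periodic_zeta (Suc n) (3 / 4)))"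
    by (simp add: numeral_2_eq_2 lessThan_Suc add.commute del: times_complex.sel)
  moreover have "bernoulli_poly (Suc n) (1 / 2) = 2 ^ n * (bernoulli_poly (Suc n) (1 / 4) + bernoulli_poly (Suc n) (3 / 4))"
    using bernoulli_poly_duplication [of "Suc n" "1 / 4"] by simp
  ultimately have "g (1 / 2) = 2 ^ n * (g (1 / 4) + g (3 / 4))"
    unfolding g_def by (simp add: algebra_simps del: times_complex.sel)
  then have "K = 2 ^ n * (2 * K)"
    by (simp add: K)
  moreover have "(1 :: real) < 2 ^ n * 2"
    using one_le_power [of "2 :: real" n] by linarith
  ultimately have "K = 0"
    by (simp add: mult.assoc [symmetric])
  then show ?case
    using K [of x] Suc.prems by (simp add: g_def)
qed

text \<open>
  For \<open>n \<ge> 2\<close> both sides are continuous, which adds the endpoint \<open>0\<close>.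
\<close>

lemma bernoulli_poly_eq_periodic_zeta:
  assumes "1 \<le> n" "x \<in> (if n = 1 then {0<..<1} else {0..<1})"
  shows "bernoulli_poly n x = bernoulli_factor n * Re (phase n * periodic_zeta n x)"
proof (cases "0 < x")
  case True
  then show ?thesis
    using assms by (intro bernoulli_poly_eq_periodic_zeta_open) (auto split: if_splits)
next
  case False
  with assms have "2 \<le> n" "x = 0" by (auto split: if_splits)
  have closure: "closure {0<..<1::real} = {0..1}" by simp
  obtain m where m: "n = Suc m" using \<open>2 \<le> n\<close> by (cases n) auto
  have "continuous_on A (bernoulli_poly n)" for A
    unfolding m by (meson DERIV_isCont bernoulli_poly_has_derivative continuous_at_imp_continuous_on)
  then have "continuous_on (closure {0<..<1}) (\<lambda>y. bernoulli_poly n y - bernoulli_factor n * Re (phase n * periodic_zeta n y))"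
    by (intro continuous_intros continuous_on_periodic_zeta \<open>2 \<le> n\<close>)
  then have "bernoulli_poly n x - bernoulli_factor n * Re (phase n * periodic_zeta n x) = 0"
    by (rule continuous_constant_on_closure)
      (use assms \<open>x = 0\<close> bernoulli_poly_eq_periodic_zeta_open closure in auto)
  then show ?thesis by simp
qed

lemma bernoulli_conj_eq_periodic_zeta:
  assumes "1 \<le> n" "2 \<le> n \<or> x \<notin> \<int>"
  shows "bernoulli_conj n x = bernoulli_factor n * Im (phase n * periodic_zeta n x)"
proof -
  have "Im (phase n * (fourier_char (int (Suc k)) x / of_nat (Suc k) ^ n))
      = sin (2 * pi * real (Suc k) * x - real n * pi / 2) / real (Suc k) ^ n" for k
  proof -
    have "phase n * (fourier_char (int (Suc k)) x / of_nat (Suc k) ^ n)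
        = cis (2 * pi * real (Suc k) * x - real n * pi / 2) / of_real (real (Suc k) ^ n)"
      by (simp add: phase_def fourier_char_def cis_mult del: of_nat_Suc)
    then show ?thesis
      by (simp only: Im_divide_of_real cis.sel)
  qed
  then have "(\<lambda>k. sin (2 * pi * real (Suc k) * x - real n * pi / 2) / real (Suc k) ^ n)
      sums Im (phase n * periodic_zeta n x)"
    using sums_Im [OF sums_mult [OF periodic_zeta_sums [OF assms], of "phase n"]] by simp
  then show ?thesis
    by (simp add: bernoulli_conj_def bernoulli_factor_def sums_iff)
qed

text \<open>
  The Bernoulli polynomial and its conjugate are, up to a common nonzero real factor, the real and
  imaginary part of the periodic zeta function rotated by \<open>phase n\<close>. Rotation is invertible, so
  they span the same real plane as the cosine and the sine series.
\<close>

lemma bernoulli_form_iff: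
  assumes "1 \<le> n"
  shows "bernoulli_form n f \<longleftrightarrow>
    (\<exists>w. \<forall>x\<in>(if n = 1 then {0<..<1} else {0..<1}). f x = Re (w * periodic_zeta n x))"
    (is "_ \<longleftrightarrow> (\<exists>w. \<forall>x\<in>?I. _)")
proof -
  have pointwise: "f x = l * bernoulli_poly n x + m * bernoulli_conj n x
      \<longleftrightarrow> f x = Re (of_real (bernoulli_factor n) * Complex l (- m) * phase n * periodic_zeta n x)"
    if "x \<in> ?I" for l m x
  proof -
    have "2 \<le> n \<or> x \<notin> \<int>"
      using that \<open>1 \<le> n\<close> nonint_unit_interval [of x] by (auto split: if_splits)
    then have "l * bernoulli_poly n x + m * bernoulli_conj n x
        = bernoulli_factor n * Re (Complex l (- m) * (phase n * periodic_zeta n x))"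
      using bernoulli_poly_eq_periodic_zeta [OF \<open>1 \<le> n\<close> that] bernoulli_conj_eq_periodic_zeta [OF \<open>1 \<le> n\<close>, of x]
      by (simp only: times_complex.sel(1) [of "Complex l (- m)"] complex.sel) (simp add: algebra_simps del: times_complex.sel)
    moreover have "Re (of_real b * z) = b * Re z" for b z
      by simp
    ultimately show ?thesis
      by (simp only: mult.assoc)
  qed
  have "bernoulli_form n f \<longleftrightarrow> (\<exists>l m. \<forall>x\<in>?I.
      f x = Re (of_real (bernoulli_factor n) * Complex l (- m) * phase n * periodic_zeta n x))"
    unfolding bernoulli_form_def by (intro ex_cong1 ball_cong refl pointwise)
  also have "\<dots> \<longleftrightarrow> (\<exists>w. \<forall>x\<in>?I. f x = Re (w * periodic_zeta n x))"
  proof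
    assume "\<exists>w. \<forall>x\<in>?I. f x = Re (w * periodic_zeta n x)"
    then obtain w where w: "\<forall>x\<in>?I. f x = Re (w * periodic_zeta n x)" by blast
    define u where "u = w / (of_real (bernoulli_factor n) * phase n)"
    have "of_real (bernoulli_factor n) * phase n \<noteq> 0"
      using bernoulli_factor_nonzero by (simp add: phase_def)
    then have "of_real (bernoulli_factor n) * Complex (Re u) (- (- Im u)) * phase n = w"
      by (simp add: u_def field_simps)
    with w have "\<forall>x\<in>?I. f x = Re (of_real (bernoulli_factor n) * Complex (Re u) (- (- Im u)) * phase n * periodic_zeta n x)"
      by metis
    then show "\<exists>l m. \<forall>x\<in>?I. f x = Re (of_real (bernoulli_factor n) * Complex l (- m) * phase n * periodic_zeta n x)"
      by blast
  qed blast
  finally show ?thesis .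
qed

section \<open>Solutions of the functional equations\<close>

lemma fourier_expandable_iff:
  "fourier_expandable_on D f \<longleftrightarrow> (\<exists>c. \<forall>x\<in>D. (\<lambda>N. sym_sum c N x) \<longlonglongrightarrow> complex_of_real (f x))"
  by (simp add: fourier_expandable_on_def sym_sum_def fourier_char_eq_exp)

theorem corollary3p10:
  fixes n :: nat and D :: "real set" and f :: "real \<Rightarrow> real"
  assumes "n \<ge> 1"
    and "D = UNIV \<or> (n = 1 \<and> D = - \<int>)"
    and "periodic1_on D f"
    and "fourier_expandable_on D f"
  shows "((\<forall>a\<ge>2. functional_eq_on D n a f) \<longleftrightarrow> trig_form_on D n f) \<and>
         (trig_form_on D n f \<longleftrightarrow> bernoulli_form n f)"
proof -
  have D: "D = UNIV \<or> D = - \<int>"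
    using assms(2) by auto
  obtain c where c: "\<And>x. x \<in> D \<Longrightarrow> (\<lambda>N. sym_sum c N x) \<longlonglongrightarrow> complex_of_real (f x)"
    using assms(4) by (auto simp: fourier_expandable_iff)
  \<comment> \<open>Periodicity is usable only inside the domain, which contains all nonintegers.\<close>
  have f_frac: "f (frac x) = f x" if "x \<notin> \<int>" for x
  proof -
    have shift: "f (y + real m) = f y" if "y \<notin> \<int>" for y m
    proof (induction m)
      case (Suc m)
      have "y + real m \<notin> \<int>"
        using that Ints_diff [of "y + real m" "real m"] by auto
      then have "f (y + real m + 1) = f (y + real m)"
        using assms(3) D by (auto simp: periodic1_on_def)
      then show ?case
        using Suc.IH by (simp add: ac_simps)
    qed simp
    show ?thesis
    proof (cases "0 \<le> \<lfloor>x\<rfloor>")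
      case True
      have "frac x \<notin> \<int>"
        using that by simp
      from shift [OF this, of "nat \<lfloor>x\<rfloor>"] True show ?thesis
        by (simp add: frac_def)
    next
      case False
      with shift [OF that, of "nat (- \<lfloor>x\<rfloor>)"] show ?thesis
        by (simp add: frac_def)
    qed
  qed
  have "trig_form_on D n f" if eq: "\<forall>a\<ge>2. functional_eq_on D n a f"
  proof -
    have mult: "of_nat a ^ n * c (int a * k) = c k" if "2 \<le> a" for a k
      using that eq by (intro coeffs_of_functional_eq [OF D _ assms(1) c]) auto
    note coeff = power_law_of_multiplicative [of n c, OF mult assms(1)]
    \<comment> \<open>The sums are real, so the terms may be replaced by their real parts, which merges the
      coefficients at \<open>1\<close> and \<open>- 1\<close>.\<close>
    define w where "w = c 1 + cnj (c (- 1))"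
    have "(\<lambda>k. Re (w * (fourier_char (int (Suc k)) x / of_nat (Suc k) ^ n))) sums f x" if "x \<in> D" for x
    proof -
      have "Re (w * (fourier_char (int (Suc k)) x / of_nat (Suc k) ^ n))
          = Re (c (int (Suc k)) * fourier_char (int (Suc k)) x
              + c (- int (Suc k)) * fourier_char (- int (Suc k)) x)" for k
      proof -
        have "Re (cnj (c (- 1)) * (fourier_char (int (Suc k)) x / of_nat (Suc k) ^ n))
            = Re (cnj (cnj (c (- 1)) * (fourier_char (int (Suc k)) x / of_nat (Suc k) ^ n)))"
          by (simp only: cnj.sel)
        also have "\<dots> = Re (c (- int (Suc k)) * fourier_char (- int (Suc k)) x)"
          by (simp add: coeff fourier_char_uminus del: of_nat_Suc times_complex.sel)
        finally show ?thesis
          by (simp add: w_def coeff(2) distrib_right add_divide_distrib del: of_nat_Suc times_complex.sel)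
      qed
      then have "(\<Sum>k<N. Re (w * (fourier_char (int (Suc k)) x / of_nat (Suc k) ^ n))) = Re (sym_sum c N x)" for N
        by (simp add: sym_sum_eq_sum coeff(1) del: of_nat_Suc times_complex.sel)
      then show ?thesis
        using tendsto_Re [OF c [OF that]] by (simp add: sums_def)
    qed
    then show ?thesis
      unfolding trig_form_iff [OF assms(1)] by blast
  qed
  moreover have "functional_eq_on D n a f" if trig: "trig_form_on D n f" and "2 \<le> a" for a
  proof -
    obtain w where "\<forall>x\<in>D. (\<lambda>k. Re (w * (fourier_char (int (Suc k)) x / of_nat (Suc k) ^ n))) sums f x"
      using trig unfolding trig_form_iff [OF assms(1)] ..
    then have w: "(\<lambda>N. sym_sum (power_law_coeff n w) N x) \<longlonglongrightarrow> complex_of_real (f x)" if "x \<in> D" for x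
      using that by (simp only: sym_sum_power_law_coeff_tendsto_iff)
    have "1 \<le> a" using \<open>2 \<le> a\<close> by simp
    then show ?thesis
      by (intro functional_eq_of_coeffs [OF D _ assms(1) w] power_law_coeff_mult)
  qed
  moreover have "bernoulli_form n f" if trig: "trig_form_on D n f"
  proof -
    obtain w where w: "\<forall>x\<in>D. (\<lambda>k. Re (w * (fourier_char (int (Suc k)) x / of_nat (Suc k) ^ n))) sums f x"
      using trig unfolding trig_form_iff [OF assms(1)] ..
    have "f x = Re (w * periodic_zeta n x)" if x: "x \<in> (if n = 1 then {0<..<1} else {0..<1})" for x
    proof (rule sums_unique2)
      have "2 \<le> n \<or> x \<notin> \<int>"
        using x assms(1) nonint_unit_interval [of x] by (auto split: if_splits)
      then show "(\<lambda>k. Re (w * (fourier_char (int (Suc k)) x / of_nat (Suc k) ^ n))) sums Re (w * periodic_zeta n x)"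
        by (intro Re_periodic_zeta_sums assms(1))
      show "(\<lambda>k. Re (w * (fourier_char (int (Suc k)) x / of_nat (Suc k) ^ n))) sums f x"
        using x assms(2) nonint_unit_interval [of x] by (intro w [rule_format]) (auto split: if_splits)
    qed
    then show ?thesis
      unfolding bernoulli_form_iff [OF assms(1)] by blast
  qed
  moreover have "trig_form_on D n f" if bern: "bernoulli_form n f"
  proof -
    obtain w where "\<forall>x\<in>(if n = 1 then {0<..<1} else {0..<1}). f x = Re (w * periodic_zeta n x)"
      using bern unfolding bernoulli_form_iff [OF assms(1)] ..
    then have w: "f x = Re (w * periodic_zeta n x)" if "0 < x" "x < 1" for x
      using that by (auto split: if_splits)
    \<comment> \<open>The Bernoulli form prescribes \<open>f\<close> on the unit interval only. Uniqueness identifies the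
      coefficients of \<open>f\<close>, and the given expansion then yields the trigonometric form at the
      integers of the domain as well.\<close>
    have "(\<lambda>N. sym_sum (\<lambda>k. c k - power_law_coeff n w k) N x) \<longlonglongrightarrow> 0" if "x \<notin> \<int>" for x
    proof -
      have "0 < frac x" "frac x < 1"
        using that by (auto simp: frac_lt_1)
      have "periodic_zeta n (frac x) = periodic_zeta n x"
        by (simp add: periodic_zeta_def fourier_char_frac)
      with w [OF \<open>0 < frac x\<close> \<open>frac x < 1\<close>] have "f x = Re (w * periodic_zeta n x)"
        by (simp only: f_frac [OF that])
      then have "(\<lambda>N. sym_sum (power_law_coeff n w) N x) \<longlonglongrightarrow> complex_of_real (f x)"
        unfolding sym_sum_power_law_coeff_tendsto_iff using assms(1) that
        by (auto simp only: intro!: Re_periodic_zeta_sums)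
      moreover have "(\<lambda>N. sym_sum c N x) \<longlonglongrightarrow> complex_of_real (f x)"
        using that D by (intro c) auto
      ultimately have "(\<lambda>N. sym_sum c N x - sym_sum (power_law_coeff n w) N x)
          \<longlonglongrightarrow> complex_of_real (f x) - complex_of_real (f x)"
        by (intro tendsto_diff)
      then show ?thesis
        by (simp only: sym_sum_diff diff_self)
    qed
    then have "c k - power_law_coeff n w k = 0" for k
      by (rule trig_series_uniqueness)
    then have "c = power_law_coeff n w"
      by (intro ext) simp
    have "(\<lambda>k. Re (w * (fourier_char (int (Suc k)) x / of_nat (Suc k) ^ n))) sums f x" if "x \<in> D" for x
      using c [OF that] unfolding \<open>c = power_law_coeff n w\<close> sym_sum_power_law_coeff_tendsto_iff .
    then show ?thesis
      unfolding trig_form_iff [OF assms(1)] by blast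
  qed
  ultimately show ?thesis by blast
qed

end
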